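(* Let $R$ be a separative exchange ring and let $A$ be a (von Neumann) regular $n\times n$ matrix over $R$, i.e. there exists $B\in M_n(R)$ with $ABA=A$. Then $A$ can be transformed into a diagonal matrix by a finite sequence of elementary row and column operations.
   Context: All rings are unital and modules are right modules. A ring $R$ is an exchange ring if for every $a\in R$ there is an idempotent $e\in aR$ with $1-e\in(1-a)R$ (equivalently, $R_R$ has the finite exchange property). $R$ is separative if for all finitely generated projective right $R$-modules $P,Q$: $P\oplus P\cong P\oplus Q\cong Q\oplus Q$ implies $P\cong Q$. An elementary row (resp. column) operation adds a left (resp. right) multiple by an element of $R$ of one row (resp. column) to a different row (resp. column); equivalently, multiplying on the left (resp. right) by a transvection $I+re_{ij}$, $i\ne j$. *)

theory Defs
  imports "Jordan_Normal_Form.Matrix"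
begin

definition exchange_ring :: "'a::ring_1 itself \<Rightarrow> bool" where
  "exchange_ring _ \<longleftrightarrow> (\<forall>a::'a. \<exists>e. e * e = e \<and> (\<exists>r. e = a * r) \<and> (\<exists>s. 1 - e = (1 - a) * s))"

text \<open>Finitely generated projective right R-modules are, up to isomorphism, the
  modules e R^m (column vectors) for idempotent matrices e in M_m(R).\<close>
definition idem_mat :: "nat \<Rightarrow> 'a::ring_1 mat \<Rightarrow> bool" where
  "idem_mat m e \<longleftrightarrow> e \<in> carrier_mat m m \<and> e * e = e"

text \<open>Isomorphism e R^m \<cong> f R^k of right R-modules: R-linear maps between these
  modules are given by left multiplication with matrices x = e x f, y = f y e;
  they are mutually inverse iff x y = e and y x = f.\<close>
definition proj_iso :: "nat \<Rightarrow> 'a::ring_1 mat \<Rightarrow> nat \<Rightarrow> 'a mat \<Rightarrow> bool" where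
  "proj_iso m e k f \<longleftrightarrow> (\<exists>x y. x \<in> carrier_mat m k \<and> y \<in> carrier_mat k m \<and>
      x = e * x * f \<and> y = f * y * e \<and> x * y = e \<and> y * x = f)"

definition dsum_mat :: "nat \<Rightarrow> 'a::ring_1 mat \<Rightarrow> nat \<Rightarrow> 'a mat \<Rightarrow> 'a mat" where
  "dsum_mat m e k f = four_block_mat e (0\<^sub>m m k) (0\<^sub>m k m) f"

definition separative :: "'a::ring_1 itself \<Rightarrow> bool" where
  "separative _ \<longleftrightarrow> (\<forall>m k (e::'a mat) f. idem_mat m e \<longrightarrow> idem_mat k f \<longrightarrow>
      proj_iso (m+m) (dsum_mat m e m e) (m+k) (dsum_mat m e k f) \<longrightarrow>
      proj_iso (m+k) (dsum_mat m e k f) (k+k) (dsum_mat k f k f) \<longrightarrow>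
      proj_iso m e k f)"

definition transvection :: "nat \<Rightarrow> nat \<Rightarrow> nat \<Rightarrow> 'a::ring_1 \<Rightarrow> 'a mat" where
  "transvection n i j r = mat n n (\<lambda>(k,l). (if k = l then 1 else 0) + (if k = i \<and> l = j then r else 0))"

definition elem_step :: "nat \<Rightarrow> 'a::ring_1 mat \<Rightarrow> 'a mat \<Rightarrow> bool" where
  "elem_step n A B \<longleftrightarrow> (\<exists>i j r. i < n \<and> j < n \<and> i \<noteq> j \<and>
      (B = transvection n i j r * A \<or> B = A * transvection n i j r))"

end

theory Submission
  imports Defs
begin

text \<open>
All matrix rings $M_n(R)$ are corners of the nonunital ring of infinite matrices with finitely many
nonzero entries, so finitely generated projective modules become idempotents of one ring, up to
Murray--von Neumann equivalence. Their classes form a refinement monoid that inherits separativity,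
hence $a + c = b + c$ implies $a = b$ whenever $c$ is a summand of both $a$ and $b$.

Write $R^n = P \oplus Q$ with $P = R$, $n \ge 2$. First, for $A$ regular with kernel $K$, image $I$ and
cokernel $C$ we have $K + I = P + Q = C + I$. Refining, moving a summand of $I$ between the two blocks,
and cancelling gives simultaneous decompositions of $K$, $I$, $C$ with $K_i + I_i = C_i + I_i$ equal
to $P$ for $i = 1$ and to $Q$ for $i = 2$; so $W A V$ is block diagonal for some units $W$, $V$.

Second, every unit $U$ is a product of a block diagonal unit and block transvections. Conjugating by
block transvections replaces an idempotent by one with the same image or the same kernel, so it
suffices to connect $U p U^{-1}$ to the projection $p$ onto $P$ by such steps. By the exchange
property the former is connected to the projection onto $P_a \oplus Q_a$ along $P_b \oplus Q_b$, where
$P = P_a \oplus P_b$ and $Q = Q_a \oplus Q_b$. Trading isomorphic summands of $P_a$ and $Q_b$ is a chain of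
steps, and after two trades $P_a$ is isomorphic to a summand of both $P_b$ and $Q_a$. Then
$P_a + P_b = P_a + Q_a$ cancels to $P_b = Q_a$, and one last trade ends at $p$.

Moving the block diagonal factors of $W$ and $V$ to the right-hand side makes $A$ block diagonal by
elementary operations alone; induction on $n$ finishes the proof.
\<close>

section \<open>Equivalence classes of idempotents\<close>

lemma mult_left_absorb: "a * b = c \<Longrightarrow> a * (b * d) = c * d" for a :: "'b::ring"
  by (metis mult.assoc)

text \<open>The rules collected in \<open>unit_trans\<close> let \<open>blast\<close> chase
  absorption and annihilation along products: relations between maps follow from the relations
  between their source and target idempotents.\<close>

lemma left_unit_trans: "a * b = b \<Longrightarrow> b * c = c \<Longrightarrow> a * c = c" for a :: "'b::ring"
  by (metis mult.assoc)

lemma right_unit_trans: "b * a = b \<Longrightarrow> c * b = c \<Longrightarrow> c * a = c" for a :: "'b::ring"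
  by (metis mult.assoc)

lemma left_zero_trans: "a * b = 0 \<Longrightarrow> b * c = c \<Longrightarrow> a * c = 0" for a :: "'b::ring"
  by (metis mult.assoc mult_zero_left)

lemma right_zero_trans: "b * a = 0 \<Longrightarrow> c * b = c \<Longrightarrow> c * a = 0" for a :: "'b::ring"
  by (metis mult.assoc mult_zero_right)

lemmas unit_trans = left_unit_trans right_unit_trans left_zero_trans right_zero_trans

definition orth :: "'b::ring \<Rightarrow> 'b \<Rightarrow> bool" where
  "orth e f \<longleftrightarrow> e * f = 0 \<and> f * e = 0"

definition below :: "'b::ring \<Rightarrow> 'b \<Rightarrow> bool" where
  "below e f \<longleftrightarrow> e * f = e \<and> f * e = e"

text \<open>Left multiplications by \<open>x\<close> and \<open>y\<close> are mutually inverse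
  isomorphisms between the right ideals of \<open>f\<close> and \<open>e\<close>. Idempotency of
  \<open>e\<close> and \<open>f\<close> is not demanded because the equations imply it.\<close>

definition mviso :: "'b::ring \<Rightarrow> 'b \<Rightarrow> 'b \<Rightarrow> 'b \<Rightarrow> bool" where
  "mviso x y e f \<longleftrightarrow> e * x = x \<and> x * f = x \<and> f * y = y \<and> y * e = y \<and> x * y = e \<and> y * x = f"

definition mv :: "'b::ring \<Rightarrow> 'b \<Rightarrow> bool" where
  "mv e f \<longleftrightarrow> (\<exists>x y. mviso x y e f)"

lemma mvisoD:
  assumes "mviso x y e f"
  shows "e * x = x" "x * f = x" "f * y = y" "y * e = y" "x * y = e" "y * x = f"
    "e * e = e" "f * f = f"
  using assms unfolding mviso_def by (metis mult.assoc)+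

lemma mviso_refl: "e * e = e \<Longrightarrow> mviso e e e e"
  by (simp add: mviso_def)

lemma mviso_sym: "mviso x y e f \<Longrightarrow> mviso y x f e"
  by (auto simp: mviso_def)

lemma mviso_trans:
  assumes "mviso x y e f" and "mviso x' y' f g"
  shows "mviso (x * x') (y' * y) e g"
proof -
  note h = mvisoD[OF assms(1)] mvisoD[OF assms(2)]
  show ?thesis
    unfolding mviso_def by (simp add: mult.assoc h h[THEN mult_left_absorb])
qed

lemma mviso_add:
  assumes "mviso x y e f" and "mviso x' y' e' f'" and "orth e e'" and "orth f f'"
  shows "mviso (x + x') (y + y') (e + e') (f + f')"
proof -
  note h = mvisoD[OF assms(1)] mvisoD[OF assms(2)]
  have o: "e * e' = 0" "e' * e = 0" "f * f' = 0" "f' * f = 0"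
    using assms(3,4) by (auto simp: orth_def)
  have z: "e * x' = 0" "e' * x = 0" "f * y' = 0" "f' * y = 0"
    "x * f' = 0" "x' * f = 0" "y * e' = 0" "y' * e = 0"
    using h o by (blast intro: unit_trans)+
  then have w: "x * y' = 0" "x' * y = 0" "y * x' = 0" "y' * x = 0"
    using h by (blast intro: unit_trans)+
  show ?thesis
    unfolding mviso_def by (simp add: algebra_simps h z w)
qed

lemma mv_refl: "e * e = e \<Longrightarrow> mv e e"
  using mviso_refl mv_def by blast

lemma mv_sym: "mv e f \<Longrightarrow> mv f e"
  using mviso_sym mv_def by blast

lemma mv_trans: "mv e f \<Longrightarrow> mv f g \<Longrightarrow> mv e g"
  using mviso_trans unfolding mv_def by blast

lemma mv_idem: "mv e f \<Longrightarrow> e * e = e" "mv e f \<Longrightarrow> f * f = f"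
  by (auto simp: mv_def intro: mvisoD)

lemma mv_add: "mv e f \<Longrightarrow> mv e' f' \<Longrightarrow> orth e e' \<Longrightarrow> orth f f' \<Longrightarrow> mv (e + e') (f + f')"
  using mviso_add unfolding mv_def by blast

lemma orth_sym: "orth e f \<Longrightarrow> orth f e"
  by (auto simp: orth_def)

lemma idem_add: "e * e = e \<Longrightarrow> f * f = f \<Longrightarrow> orth e f \<Longrightarrow> (e + f) * (e + f) = e + f" for e :: "'b::ring"
  by (simp add: algebra_simps orth_def)

text \<open>Nonunital rings in which every pair of idempotents has orthogonal copies, like finite
  matrices of unbounded size.\<close>

class stable_ring = ring +
  assumes orth_copy: "e * e = e \<Longrightarrow> f * f = f \<Longrightarrow>
    \<exists>x y g. e * g = 0 \<and> g * e = 0 \<and> f * x = x \<and> x * g = x \<and> g * y = y \<and> y * f = y \<and> x * y = f \<and> y * x = g"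

section \<open>The commutative monoid of classes of idempotents\<close>

lemma orth_copy_mv:
  fixes e f :: "'b::stable_ring"
  assumes "e * e = e" "f * f = f"
  obtains g where "mv f g" "orth e g"
  using orth_copy[OF assms] unfolding mv_def mviso_def orth_def by metis

\<comment> \<open>The quotient is partial since \<open>mv\<close> is reflexive exactly on the
  idempotents. Addition of classes will model the direct sum of finitely generated projective
  modules.\<close>
quotient_type (overloaded) 'b idem_class = "'b::stable_ring" / partial: mv
proof (rule part_equivpI)
  show "\<exists>x::'b. mv x x" using mv_refl[of 0] by auto
  show "symp (mv :: 'b \<Rightarrow> _)" using mv_sym by (rule sympI)
  show "transp (mv :: 'b \<Rightarrow> _)" using mv_trans by (rule transpI)
qed

abbreviation cls :: "'b::stable_ring \<Rightarrow> 'b idem_class" where "cls \<equiv> abs_idem_class"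

lemma cls_eq: "e * e = e \<Longrightarrow> f * f = f \<Longrightarrow> cls e = cls f \<longleftrightarrow> mv e f"
  using Quotient_rel[OF Quotient_idem_class, of e f] mv_refl by blast

lemma cls_surj: "\<exists>e. e * e = e \<and> cls e = x"
  using Quotient_abs_rep[OF Quotient_idem_class, of x] Quotient_rep_reflp[OF Quotient_idem_class, of x] mv_idem
  by blast

lemma cls_surj_orth:
  assumes "e * e = e"
  shows "\<exists>f. f * f = f \<and> orth e f \<and> cls f = x"
proof -
  obtain f where f: "f * f = f" "cls f = x" using cls_surj by blast
  obtain g where "mv f g" "orth e g" using orth_copy_mv[OF assms f(1)] by blast
  then show ?thesis using f mv_idem cls_eq by metis
qed

instantiation idem_class :: (stable_ring) comm_monoid_add
begin

definition zero_idem_class :: "'a idem_class" where "0 = cls 0"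

text \<open>A sum of idempotents is idempotent only for suitable pairs, so addition is read off from
  orthogonal representatives. These exist by \<open>orth_copy\<close>, and \<open>mv_add\<close>
  makes the result independent of their choice.\<close>

definition plus_idem_class :: "'a idem_class \<Rightarrow> 'a idem_class \<Rightarrow> 'a idem_class" where
  "x + y = (THE z. \<exists>e f. e * e = e \<and> f * f = f \<and> orth e f \<and> x = cls e \<and> y = cls f \<and> z = cls (e + f))"

lemma cls_add:
  assumes "e * e = e" "f * f = f" "orth e f"
  shows "cls e + cls f = cls (e + f)"
  unfolding plus_idem_class_def
proof (rule the_equality)
  fix z assume "\<exists>e' f'. e' * e' = e' \<and> f' * f' = f' \<and> orth e' f' \<and> cls e = cls e' \<and> cls f = cls f' \<and> z = cls (e' + f')"
  then obtain e' f' where h: "e' * e' = e'" "f' * f' = f'" "orth e' f'" "cls e = cls e'"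
    "cls f = cls f'" "z = cls (e' + f')" by blast
  then have "mv e e'" "mv f f'" using assms cls_eq by metis+
  then have "mv (e + f) (e' + f')" using mv_add assms h by blast
  then show "z = cls (e + f)" using h cls_eq mv_idem by metis
qed (use assms in blast)

instance
proof
  fix x y z :: "'a idem_class"
  obtain e where e: "e * e = e" "cls e = x" using cls_surj by blast
  obtain f where f: "f * f = f" "orth e f" "cls f = y" using cls_surj_orth[OF e(1)] by blast
  have ef: "(e + f) * (e + f) = e + f" using e f idem_add by blast
  obtain g where g: "g * g = g" "orth (e + f) g" "cls g = z" using cls_surj_orth[OF ef] by blast
  have z: "(e + f) * g = 0" "g * (e + f) = 0" "e * f = 0" "f * e = 0" using g f by (auto simp: orth_def)
  have "e * (e + f) = e" "f * (e + f) = f" "(e + f) * e = e" "(e + f) * f = f"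
    using z e f by (simp_all add: distrib_left distrib_right)
  then have "e * g = 0" "f * g = 0" "g * e = 0" "g * f = 0"
    using z(1,2) by (metis mult.assoc mult_zero_left mult_zero_right)+
  then have o: "orth f g" "orth e (f + g)" using f by (auto simp: orth_def algebra_simps)
  have fg: "(f + g) * (f + g) = f + g" using f g o idem_add by blast
  show "x + y + z = x + (y + z)"
    using cls_add[OF e(1) f(1) f(2)] cls_add[OF ef g(1) g(2)]
      cls_add[OF f(1) g(1) o(1)] cls_add[OF e(1) fg o(2)] e f g
    by (simp add: add.assoc)
  show "x + y = y + x"
    using cls_add[OF e(1) f(1) f(2)] cls_add[OF f(1) e(1) orth_sym[OF f(2)]] e f
    by (simp add: add.commute)
  show "0 + x = x"
    using cls_add[of 0 e] e by (auto simp: zero_idem_class_def orth_def)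
qed

end

lemma below_diff:
  assumes "e * e = e" "below f e" "f * f = f"
  shows "(e - f) * (e - f) = e - f" "orth f (e - f)" "below (e - f) e"
  using assms by (auto simp: below_def orth_def algebra_simps)

text \<open>A decomposition of the class is realized inside \<open>e\<close> itself: orthogonal
  representatives \<open>f\<close>, \<open>g\<close> of the summands are carried over by an
  isomorphism from \<open>f + g\<close> to \<open>e\<close>.\<close>

lemma cls_split:
  assumes "e * e = e" "cls e = x + y"
  obtains e1 e2 where "e = e1 + e2" "e1 * e1 = e1" "e2 * e2 = e2" "orth e1 e2" "cls e1 = x" "cls e2 = y"
proof -
  obtain f where f: "f * f = f" "cls f = x" using cls_surj by blast
  obtain g where g: "g * g = g" "orth f g" "cls g = y" using cls_surj_orth[OF f(1)] by blast
  have "cls e = cls (f + g)" using assms f g cls_add by metis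
  then have "mv e (f + g)" using assms f g idem_add cls_eq by metis
  then obtain u v where uv: "mviso u v e (f + g)" unfolding mv_def by blast
  note h = mvisoD[OF uv]
  have fg: "f * g = 0" "g * f = 0" using g by (auto simp: orth_def)
  note r = f(1) g(1) fg f(1)[THEN mult_left_absorb] g(1)[THEN mult_left_absorb] fg[THEN mult_left_absorb]
  have r2: "v * (u * z) = f * z + g * z" for z using h(6) by (metis mult.assoc distrib_right)
  have m1: "mviso (u * f) (f * v) (u * f * v) f"
    unfolding mviso_def using r r2 h(6) by (simp add: mult.assoc distrib_left)
  have m2: "mviso (u * g) (g * v) (u * g * v) g"
    unfolding mviso_def using r r2 h(6) by (simp add: mult.assoc distrib_left)
  have "e = u * (f + g) * v" by (simp only: h(2) h(5))
  then have s: "e = u * f * v + u * g * v" by (simp only: distrib_left distrib_right)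
  have o: "orth (u * f * v) (u * g * v)"
    unfolding orth_def using r r2 by (simp add: mult.assoc distrib_left)
  show ?thesis
  proof (rule that[OF s _ _ o])
    show "u * f * v * (u * f * v) = u * f * v" "u * g * v * (u * g * v) = u * g * v"
      using mvisoD(7)[OF m1] mvisoD(7)[OF m2] by auto
    then show "cls (u * f * v) = x" "cls (u * g * v) = y"
      using m1 m2 f(1,2) g(1,3) cls_eq[of "u * f * v" f] cls_eq[of "u * g * v" g] mv_def by blast+
  qed
qed

section \<open>The exchange property\<close>

text \<open>This is the exchange condition in the corner ring $uTu$ of $T$: the witnesses $r$, $s$ may be
  arbitrary because they can be replaced by $urg$ and $us(u - g)$.\<close>

definition exch :: "'b::ring \<Rightarrow> bool" where
  "exch u \<longleftrightarrow> (\<forall>a. u * a = a \<longrightarrow> a * u = a \<longrightarrow>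
     (\<exists>g r s. g * g = g \<and> g * u = g \<and> a * r = g \<and> (u - a) * s = u - g))"

text \<open>The two-generator form of exchange: the corner element \<open>x1 * y1 * u\<close> has
  complement \<open>x2 * y2 * u\<close>, so exchange applies to it. Normalizing by
  \<open>z1 * g1 = z1\<close> and \<open>z2 * g2 = z2\<close> makes the mixed products
  \<open>z1 * g2\<close> and \<open>z2 * g1\<close> vanish.\<close>

lemma exch_pair:
  assumes "exch u" "u * u = u" "u * x1 = x1" "u * x2 = x2" "x1 * y1 + x2 * y2 = u"
  obtains g1 g2 z1 z2 where "g1 * g1 = g1" "g2 * g2 = g2" "g1 * g2 = 0" "g2 * g1 = 0" "g1 + g2 = u"
    "x1 * z1 = g1" "x2 * z2 = g2" "z1 * g1 = z1" "z2 * g2 = z2"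
proof -
  define a where "a = x1 * y1 * u"
  have a: "u * a = a" "a * u = a" using assms(2,3) by (simp_all add: a_def mult.assoc[symmetric])
      (simp add: mult.assoc)
  have ua: "u - a = x2 * y2 * u"
    using assms(2,5) by (metis a_def add_diff_cancel_left' distrib_right)
  obtain g r s where g: "g * g = g" "g * u = g" "a * r = g" "(u - a) * s = u - g"
    using assms(1) a unfolding exch_def by blast
  have ug: "u * g = g" using g(3) a(1) by (metis mult.assoc)
  have gg: "(u - g) * (u - g) = u - g" "g * (u - g) = 0" "(u - g) * g = 0"
    using g ug assms(2) by (simp_all add: algebra_simps)
  show ?thesis
  proof (rule that[of g "u - g" "y1 * u * r * g" "y2 * u * s * (u - g)"])
    show "x1 * (y1 * u * r * g) = g" using g by (metis a_def mult.assoc)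
    show "x2 * (y2 * u * s * (u - g)) = u - g" using g(4) gg(1) ua by (metis mult.assoc)
  qed (use g gg in \<open>simp_all add: mult.assoc\<close>)
qed

text \<open>An element \<open>a\<close> of the smaller corner is treated in the larger one. The
  resulting \<open>g\<close> lies in the right ideal of \<open>a\<close>, hence
  \<open>f * g = g\<close>, and cutting it on the right to \<open>g * f\<close> yields an idempotent
  of the smaller corner.\<close>

lemma exch_corner:
  assumes "exch u" "u * u = u" "f * f = f" "below f u"
  shows "exch f"
  unfolding exch_def
proof (intro allI impI)
  fix a assume a: "f * a = a" "a * f = a"
  have fu: "f * u = f" "u * f = f" using assms(4) by (auto simp: below_def)
  have "u * a = a" "a * u = a" using a fu by (blast intro: unit_trans)+
  then obtain g r s where g: "g * g = g" "g * u = g" "a * r = g" "(u - a) * s = u - g"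
    using assms(1) unfolding exch_def by blast
  have fg: "f * g = g" using g(3) a(1) by (metis mult.assoc)
  have "f * (u - g) * f = f * (u - a) * s * f" by (simp add: g(4)[symmetric] mult.assoc)
  then have "f - g * f = (f - a) * (s * f)"
    using fg fu a assms(3) by (simp add: right_diff_distrib left_diff_distrib mult.assoc)
  moreover have "g * f * (g * f) = g * f" using fg g(1) by (metis mult.assoc)
  moreover have "a * (r * f) = g * f" using g(3) by (simp add: mult.assoc[symmetric])
  ultimately show "\<exists>g r s. g * g = g \<and> g * f = g \<and> a * r = g \<and> (f - a) * s = f - g"
    using assms(3) by (metis mult.assoc)
qed

text \<open>The decomposition $p = g_1 + g_2$ is already inside the right ideals of $x_1$ and $x_2$. Removing
  from the rows the part visible in $g_1$ and $g_2$ leaves rows that generate $q$; the exchange property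
  of $q$ then gives $G$ up to conjugation by a unipotent element.\<close>

lemma exch_add_reduced:
  assumes q: "exch q" "q * q = q" and p: "p * p = p" and pq: "p * q = 0" "q * p = 0" and u: "u = p + q"
    and ux: "u * x1 = x1" "u * x2 = x2" and y: "x1 * y1 + x2 * y2 = u"
    and g: "g1 * g1 = g1" "g2 * g2 = g2" "g1 * g2 = 0" "g2 * g1 = 0" "g1 + g2 = p"
    and z: "x1 * z1 = g1" "x2 * z2 = g2"
  shows "\<exists>G t1 t2. G * G = G \<and> G * u = G \<and> x1 * t1 = G \<and> x2 * t2 = u - G"
proof -
  have pg: "p * g1 = g1" "p * g2 = g2" "g1 * p = g1" "g2 * p = g2"
    using g by (auto simp: g(5)[symmetric] algebra_simps)
  have qg: "q * g1 = 0" "q * g2 = 0" "g1 * q = 0" "g2 * q = 0"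
    using pg pq by (blast intro: unit_trans)+
  define c where "c = p * (x1 * y1) * q"
  have uq: "u * q = q" and pu: "p * u = p" using u p q pq by (simp_all add: algebra_simps)
  have c2: "p * (x2 * y2) * q = - c"
  proof -
    have "p * (x1 * y1 + x2 * y2) * q = 0" using y pu pq by simp
    then show ?thesis unfolding c_def by (simp add: algebra_simps add_eq_0_iff)
  qed
  have pc: "p * c = c" "c * q = c" "q * c = 0"
    unfolding c_def using p pq q by (simp_all add: mult.assoc p[THEN mult_left_absorb] pq[THEN mult_left_absorb])
  \<comment> \<open>\<open>c\<close> is the off-diagonal part of \<open>x1 * y1\<close> from
    \<open>q\<close> to \<open>p\<close>; that of \<open>x2 * y2\<close> is \<open>- c\<close>. The
    corrections remove the \<open>g1\<close> part of the first and the \<open>g2\<close> part of the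
    second, staying in the right ideals of \<open>x1\<close> and \<open>x2\<close> and leaving the
    \<open>q\<close> components unchanged.\<close>
  define t1 where "t1 = x1 * (y1 * q - z1 * c)"
  define t2 where "t2 = x2 * (y2 * q + z2 * c)"
  have t: "t1 = x1 * y1 * q - g1 * c" "t2 = x2 * y2 * q + g2 * c"
    unfolding t1_def t2_def by (simp_all add: algebra_simps mult_left_absorb[OF z(1)] mult_left_absorb[OF z(2)])
  have pt: "p * t1 = g2 * c" "p * t2 = - (g1 * c)"
  proof -
    have gc: "c = g1 * c + g2 * c" using pc(1) g(5) by (metis distrib_right)
    have "p * t1 = c - g1 * c" unfolding t(1) c_def using pg(1)
      by (simp add: right_diff_distrib mult.assoc mult_left_absorb[OF pg(1)])
    then show "p * t1 = g2 * c" using gc by (metis add_diff_cancel_left')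
    have "p * t2 = - c + g2 * c" unfolding t(2) using c2[unfolded mult.assoc]
      by (simp add: distrib_left mult.assoc mult_left_absorb[OF pg(2)])
    then show "p * t2 = - (g1 * c)" using gc by (metis add.commute add_uminus_conv_diff minus_diff_eq add_diff_cancel_right')
  qed
  have tq: "t1 * q = t1" "t2 * q = t2" unfolding t using q pc by (simp_all add: algebra_simps)
  have "q * t1 + q * t2 = q * (x1 * y1 + x2 * y2) * q"
    unfolding t by (simp add: algebra_simps mult_left_absorb[OF qg(1)] mult_left_absorb[OF qg(2)])
  then have "q * t1 * q + q * t2 * q = q" using y uq q tq by (simp add: mult.assoc)
  moreover have "q * (q * t1) = q * t1" "q * (q * t2) = q * t2" using q(2) by (metis mult.assoc)+
  ultimately obtain k1 k2 s1 s2 where k: "k1 * k1 = k1" "k2 * k2 = k2" "k1 * k2 = 0" "k2 * k1 = 0" "k1 + k2 = q"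
    and s: "q * t1 * s1 = k1" "q * t2 * s2 = k2" "s1 * k1 = s1" "s2 * k2 = s2"
    using exch_pair[OF q(1) q(2), of "q * t1" "q * t2" q q] by blast
  have qk: "q * k1 = k1" "q * k2 = k2" "k1 * q = k1" "k2 * q = k2"
    using k by (auto simp: k(5)[symmetric] algebra_simps)
  have ut: "u * t1 = t1" "u * t2 = t2" unfolding t1_def t2_def using ux by (metis mult.assoc)+
  \<comment> \<open>These are the \<open>p\<close> components of \<open>t1 * s1\<close> and
    \<open>t2 * s2\<close>, whose \<open>q\<close> components are \<open>k1\<close> and
    \<open>k2\<close>. They land crosswise, \<open>al\<close> in \<open>g2\<close> and
    \<open>be\<close> in \<open>g1\<close>.\<close>
  define al where "al = g2 * c * s1"
  define be where "be = - (g1 * c * s2)"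
  have ts: "t1 * s1 = k1 + al" "t2 * s2 = k2 + be"
    using ut pt s unfolding u al_def be_def by (metis add.commute distrib_right minus_mult_left)+
  have abk: "al * k1 = al" "be * k2 = be" unfolding al_def be_def using s by (simp_all add: mult.assoc)
  have abk0: "al * k2 = 0" "be * k1 = 0" using abk k by (blast intro: unit_trans)+
  have ab: "k1 * al = 0" "k2 * al = 0" "k1 * be = 0" "k2 * be = 0" "al * g1 = 0" "al * g2 = 0"
     "be * g1 = 0" "be * g2 = 0"
  proof -
    have *: "q * al = 0" "q * be = 0" unfolding al_def be_def
      by (simp_all add: mult.assoc mult_left_absorb[OF qg(1)] mult_left_absorb[OF qg(2)])
    show "k1 * al = 0" "k2 * al = 0" "k1 * be = 0" "k2 * be = 0"
      using * qk by (blast intro: unit_trans)+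
    have "k1 * g1 = 0" "k1 * g2 = 0" "k2 * g1 = 0" "k2 * g2 = 0"
      using qk qg by (blast intro: unit_trans)+
    then show "al * g1 = 0" "al * g2 = 0" "be * g1 = 0" "be * g2 = 0"
      using abk by (blast intro: unit_trans)+
  qed
  have gk: "g1 * k1 = 0" "g1 * k2 = 0" "g2 * k1 = 0" "g2 * k2 = 0"
    "k1 * g1 = 0" "k1 * g2 = 0" "k2 * g1 = 0" "k2 * g2 = 0"
    using qk qg by (blast intro: unit_trans)+
  have ab0: "al * al = 0" "al * be = 0" "be * al = 0" "be * be = 0"
    using abk ab by (blast intro: unit_trans)+
  have gab: "g1 * al = 0" "g2 * al = al" "g1 * be = be" "g2 * be = 0"
    unfolding al_def be_def by (simp_all add: mult.assoc mult_left_absorb[OF g(3)] mult_left_absorb[OF g(4)]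
       mult_left_absorb[OF g(1)] mult_left_absorb[OF g(2)])
  have uu: "u = g1 + g2 + k1 + k2" using u g(5) k(5) by (simp add: add.assoc)
  \<comment> \<open>All products of \<open>al\<close> and \<open>be\<close> vanish, so
    \<open>u + al + be\<close> is a unit of the corner with inverse \<open>u - al - be\<close>.
    \<open>G\<close> is the conjugate of \<open>g1 + k1\<close> by it, and \<open>u - G\<close> that
    of \<open>g2 + k2\<close>.\<close>
  define G where "G = (g1 + k1 + al) * (u - al - be)"
  note R = g(1-4) k(1-4) abk abk0 ab gk ab0 gab
  have "(u - al - be) * (g1 + k1 + al) = g1 + k1"
    unfolding uu by (simp add: algebra_simps R)
  moreover have "(g1 + k1 + al) * (g1 + k1) = g1 + k1 + al"
    by (simp add: algebra_simps R)
  ultimately have "G * G = G" unfolding G_def by (metis mult.assoc)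
  moreover have "G * u = G" unfolding G_def uu by (simp add: algebra_simps R)
  moreover have "x1 * (z1 + (y1 * q - z1 * c) * s1) = g1 + k1 + al"
    using ts(1)[unfolded t1_def mult.assoc] z(1) by (simp only: distrib_left[of x1] mult.assoc add.assoc)
  then have "x1 * ((z1 + (y1 * q - z1 * c) * s1) * (u - al - be)) = G"
    unfolding G_def by (metis mult.assoc)
  moreover have "x2 * (z2 + (y2 * q + z2 * c) * s2) = g2 + k2 + be"
    using ts(2)[unfolded t2_def mult.assoc] z(2) by (simp only: distrib_left[of x2] mult.assoc add.assoc)
  then have "x2 * ((z2 + (y2 * q + z2 * c) * s2) * (u - al - be)) = (g2 + k2 + be) * (u - al - be)"
    by (metis mult.assoc)
  moreover have "(g2 + k2 + be) * (u - al - be) = u - G"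
    unfolding G_def uu by (simp add: algebra_simps R)
  ultimately show ?thesis by metis
qed

text \<open>Exchange passes to orthogonal sums. Exchange in \<open>p\<close> gives
  \<open>a * z1\<close> and \<open>b * z2\<close> with the right \<open>p\<close> components;
  \<open>n\<close> collects their \<open>q\<close> components and has square zero. Left
  multiplication by \<open>u - n\<close> clears them, which is the situation of
  \<open>exch_add_reduced\<close>, and the idempotent found there is conjugated back by
  \<open>u + n\<close>.\<close>

lemma exch_add:
  assumes p: "exch p" "p * p = p" and q: "exch q" "q * q = q" and pq: "p * q = 0" "q * p = 0"
  shows "exch (p + q)"
  unfolding exch_def
proof (intro allI impI)
  define u where "u = p + q"
  fix a assume a: "(p + q) * a = a" "a * (p + q) = a"
  have uu: "u * u = u" "u * p = p" "p * u = p" "q * u = q" "u * q = q"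
    using p q pq by (simp_all add: u_def algebra_simps)
  have ua: "u * a = a" "a * u = a" using a by (simp_all add: u_def)
  define b where "b = u - a"
  have ub: "u * b = b" "b * u = b" using uu ua by (simp_all add: b_def algebra_simps)
  have "p * a * p + p * b * p = p"
    unfolding b_def using uu p by (simp add: algebra_simps)
  moreover have "p * (p * a) = p * a" "p * (p * b) = p * b" using p(2) by (metis mult.assoc)+
  ultimately obtain g1 g2 z1 z2 where
    g: "g1 * g1 = g1" "g2 * g2 = g2" "g1 * g2 = 0" "g2 * g1 = 0" "g1 + g2 = p"
    and z: "p * a * z1 = g1" "p * b * z2 = g2" "z1 * g1 = z1" "z2 * g2 = z2"
    using exch_pair[OF p(1) p(2), of "p * a" "p * b" p p] by blast
  define n where "n = q * (a * z1 + b * z2)"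
  have gp: "g1 * p = g1" "g2 * p = g2" using g by (auto simp: g(5)[symmetric] algebra_simps)
  have zp: "z1 * p = z1" "z2 * p = z2" using gp z(3,4) by (blast intro: unit_trans)+
  have n: "q * n = n" "n * p = n" "p * n = 0" "n * q = 0" "n * n = 0" "u * n = n" "n * u = n"
  proof -
    show 1: "q * n = n" "p * n = 0" unfolding n_def using q pq by (simp_all add: mult.assoc[symmetric])
    show 2: "n * p = n" unfolding n_def using zp by (simp add: algebra_simps)
    show 3: "n * q = 0" "n * n = 0" using 1 2 pq by (blast intro: unit_trans)+
    show "u * n = n" "n * u = n" using 1 2 3 by (simp_all add: u_def algebra_simps)
  qed
  have g1n: "g1 * n = 0" "g2 * n = 0" using gp n(3) by (blast intro: unit_trans)+
  have ng: "n * g1 = q * a * z1" "n * g2 = q * b * z2"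
  proof -
    have "z1 * g2 = 0" "z2 * g1 = 0" using z g by (blast intro: unit_trans)+
    then show "n * g1 = q * a * z1" "n * g2 = q * b * z2"
      unfolding n_def using z by (simp_all add: algebra_simps)
  qed
  have az: "a * z1 = g1 + n * g1" "b * z2 = g2 + n * g2"
  proof -
    have "a * z1 = u * a * z1" "b * z2 = u * b * z2" using ua ub by simp_all
    then show "a * z1 = g1 + n * g1" "b * z2 = g2 + n * g2"
      using z ng by (simp_all add: u_def distrib_right mult.assoc)
  qed
  define x1 where "x1 = (u - n) * a"
  define x2 where "x2 = (u - n) * b"
  have "u * x1 = x1" "u * x2 = x2"
    unfolding x1_def x2_def using uu n by (metis mult.assoc right_diff_distrib)+
  moreover have "x1 * (u + n) + x2 * (u + n) = u"
  proof -
    have "x1 * (u + n) + x2 * (u + n) = (u - n) * (a + b) * (u + n)"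
      by (simp add: x1_def x2_def algebra_simps)
    also have "\<dots> = u" using uu n unfolding b_def by (simp add: algebra_simps)
    finally show ?thesis .
  qed
  moreover have "x1 * z1 = g1" "x2 * z2 = g2"
  proof -
    have "p * g1 = g1" "p * g2 = g2" using g by (auto simp: g(5)[symmetric] algebra_simps)
    then have "u * g1 = g1" "u * g2 = g2" using uu by (blast intro: unit_trans)+
    then show "x1 * z1 = g1" "x2 * z2 = g2"
      unfolding x1_def x2_def using az g1n n
      by (simp_all add: mult.assoc algebra_simps mult_left_absorb[OF n(5)] mult_left_absorb[OF n(6)])
  qed
  ultimately have "\<exists>G t1 t2. G * G = G \<and> G * u = G \<and> x1 * t1 = G \<and> x2 * t2 = u - G"
    by (rule exch_add_reduced[OF q p(2) pq u_def _ _ _ g])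
  then obtain G t1 t2 where G: "G * G = G" "G * u = G" "x1 * t1 = G" "x2 * t2 = u - G" by blast
  define H where "H = (u + n) * G * (u - n)"
  have un: "(u - n) * (u + n) = u" "(u + n) * (u - n) = u" using uu n by (simp_all add: algebra_simps)
  have x: "(u + n) * x1 = a" "(u + n) * x2 = b"
    unfolding x1_def x2_def using un ua ub by (simp_all add: mult.assoc[symmetric])
  have "H * H = (u + n) * G * ((u - n) * (u + n)) * G * (u - n)" unfolding H_def by (simp only: mult.assoc)
  also have "\<dots> = (u + n) * (G * u * G) * (u - n)" by (simp only: un mult.assoc)
  finally have "H * H = (u + n) * (G * u * G) * (u - n)" .
  then have "H * H = H" using G H_def by simp
  moreover have "H * u = H" unfolding H_def using uu n by (simp add: algebra_simps)
  moreover have "a * (t1 * (u - n)) = H" unfolding H_def using x G by (metis mult.assoc)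
  moreover have "b * (t2 * (u - n)) = u - H"
  proof -
    have "b * (t2 * (u - n)) = (u + n) * (u - G) * (u - n)" using x G by (metis mult.assoc)
    also have "\<dots> = (u + n) * u * (u - n) - H" by (simp add: H_def algebra_simps)
    also have "(u + n) * u * (u - n) = u" using un uu n by (simp add: algebra_simps)
    finally show ?thesis .
  qed
  ultimately show "\<exists>g r s. g * g = g \<and> g * (p + q) = g \<and> a * r = g \<and> (p + q - a) * s = p + q - g"
    unfolding u_def[symmetric] b_def[symmetric] by metis
qed

lemma exch_zero: "exch 0"
  by (simp add: exch_def)

section \<open>Refinement, separativity, and reduction of units\<close>

text \<open>Two idempotents of the corner $uTu$ are linked if they have the same image (first
  disjunct) or the same kernel (second disjunct).\<close>

definition link :: "'b::ring \<Rightarrow> 'b \<Rightarrow> 'b \<Rightarrow> bool" where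
  "link u f g \<longleftrightarrow> f * f = f \<and> u * f = f \<and> f * u = f \<and> g * g = g \<and> u * g = g \<and> g * u = g \<and>
     (f * g = g \<and> g * f = f \<or> f * g = f \<and> g * f = g)"

lemma link_mv: "link u f g \<Longrightarrow> mv f g"
  unfolding link_def mv_def mviso_def by metis

text \<open>Exchange of \<open>p\<close> against \<open>e1 + e2\<close>: summands \<open>h1\<close>
  of \<open>e1\<close> and \<open>h2\<close> of \<open>e2\<close> are found such that the image of
  \<open>h1 + h2\<close> is, like that of \<open>p\<close>, a complement of the image of
  \<open>n\<close>. The intermediate idempotent \<open>f\<close> has the image of \<open>n\<close>
  and the kernel of \<open>u - (h1 + h2)\<close>.\<close>

lemma exchange_complement:
  assumes p: "exch p" "p * p = p" and n: "n * n = n" "p * n = 0" "n * p = 0"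
    and e: "e1 * e1 = e1" "e2 * e2 = e2" "e1 * e2 = 0" "e2 * e1 = 0" and u: "u = p + n" "u = e1 + e2"
  obtains h1 h2 f where "h1 * h1 = h1" "h2 * h2 = h2" "below h1 e1" "below h2 e2" "mv p (h1 + h2)"
    "link u n f" "link u f (u - (h1 + h2))"
proof -
  have pu: "p * u = p" "u * p = p" "u * n = n" "n * u = n" "u * u = u" unfolding u(1) using p n by (simp_all add: algebra_simps)
  have ue: "u * e1 = e1" "u * e2 = e2" "e1 * u = e1" "e2 * u = e2" unfolding u(2) using e by (simp_all add: algebra_simps)
  have "p * e1 * p + p * e2 * p = p * (u * p)" by (simp add: u(2) algebra_simps)
  then have "p * e1 * p + p * e2 * p = p" using pu p by simp
  moreover have "p * (p * e1) = p * e1" "p * (p * e2) = p * e2" by (simp_all add: p mult.assoc[symmetric])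
  ultimately obtain g1 g2 z1 z2 where
    g: "g1 * g1 = g1" "g2 * g2 = g2" "g1 * g2 = 0" "g2 * g1 = 0" "g1 + g2 = p"
    and z: "p * e1 * z1 = g1" "p * e2 * z2 = g2" "z1 * g1 = z1" "z2 * g2 = z2"
    using exch_pair[OF p, of "p * e1" "p * e2" p p] by blast
  have gp: "g1 * p = g1" "g2 * p = g2" using g by (auto simp: g(5)[symmetric] algebra_simps)
  have zp: "z1 * p = z1" "z2 * p = z2" using gp z(3,4) by (blast intro: unit_trans)+
  have zg: "z1 * g2 = 0" "z2 * g1 = 0" using g z(3,4) by (blast intro: unit_trans)+
  have z': "p * (e1 * z1) = g1" "p * (e2 * z2) = g2" using z by (simp_all add: mult.assoc)
  have "z1 * (p * (e1 * z1)) = z1" "z2 * (p * (e2 * z2)) = z2" "z1 * (p * (e2 * z2)) = 0" "z2 * (p * (e1 * z1)) = 0"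
    using z' z(3,4) zg by simp_all
  then have zez: "z1 * (e1 * z1) = z1" "z2 * (e2 * z2) = z2" "z1 * (e2 * z2) = 0" "z2 * (e1 * z1) = 0"
    using zp by (simp_all add: mult.assoc[symmetric])
  have zezw: "z1 * (e1 * (z1 * w)) = z1 * w" "z2 * (e2 * (z2 * w)) = z2 * w"
    "z1 * (e2 * (z2 * w)) = 0" "z2 * (e1 * (z1 * w)) = 0" for w
    using zez by (metis mult.assoc mult_zero_left)+
  note R = e z' g(1-4) gp zp zg z(3,4)
  note R = R R[THEN mult_left_absorb] zez zezw
  \<comment> \<open>\<open>p * e1 * z1 = g1\<close> and \<open>z1 * g1 = z1\<close> make this the
    projection onto the image of \<open>e1 * z1\<close>; likewise for \<open>h2\<close>.\<close>
  define h1 where "h1 = e1 * z1 * p * e1"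
  define h2 where "h2 = e2 * z2 * p * e2"
  \<comment> \<open>The projection onto the image of \<open>h1 + h2\<close> along \<open>n\<close>:
    it shares its image with \<open>h1 + h2\<close> and its kernel with \<open>p\<close>. The
    linking idempotent \<open>f\<close> is \<open>u - al\<close>.\<close>
  define al where "al = e1 * z1 + e2 * z2"
  have z1pe: "p * (e1 * (z1 * w)) = g1 * w" "p * (e2 * (z2 * w)) = g2 * w" for w
    using z by (metis mult.assoc)+
  have h: "h1 * h1 = h1" "h2 * h2 = h2" "below h1 e1" "below h2 e2"
    unfolding h1_def h2_def below_def by (simp_all add: mult.assoc R z1pe)
  have al: "(h1 + h2) * al = al" "al * p = al" "p * al = p" "al * (h1 + h2) = h1 + h2"
    unfolding h1_def h2_def al_def using g(5) by (simp_all add: mult.assoc algebra_simps R z1pe)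
  have hh: "(h1 + h2) * (h1 + h2) = h1 + h2"
    unfolding h1_def h2_def using g(5) by (simp add: mult.assoc algebra_simps R z1pe)
  have alal: "al * al = al" using al by (metis mult.assoc)
  have aln: "al * n = 0" using al(2) n(2) by (blast intro: unit_trans)
  have u_h: "u * (h1 + h2) = h1 + h2" "(h1 + h2) * u = h1 + h2"
    unfolding h1_def h2_def by (simp_all add: mult.assoc distrib_left distrib_right ue ue[THEN mult_left_absorb])
  have u_al: "u * al = al" "al * u = al" using u_h al pu by (blast intro: unit_trans)+
  have n_al: "n * al = al - p" using u_al(1) al(3) unfolding u(1) by (simp add: algebra_simps)
  show ?thesis
  proof (rule that[OF h])
    have "mviso (p * (h1 + h2)) al p (h1 + h2)"
      unfolding mviso_def by (simp add: mult.assoc al hh mult_left_absorb[OF p(2)] mult_left_absorb[OF al(2)])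
    then show "mv p (h1 + h2)" unfolding mv_def by blast
    have 1: "(u - al) * (u - al) = u - al" "u * (u - al) = u - al" "(u - al) * u = u - al"
      using u_al pu alal by (simp_all add: algebra_simps)
    have "n * (u - al) = u - al" using n_al pu u(1) by (simp add: algebra_simps)
    moreover have "(u - al) * n = n" using aln pu by (simp add: algebra_simps)
    ultimately show "link u n (u - al)" unfolding link_def using 1 n pu by blast
    define h where "h = h1 + h2"
    have "(u - al) * (u - h) = u - al" using al u_al u_h pu unfolding h_def[symmetric] by (simp add: right_diff_distrib left_diff_distrib)
    moreover have "(u - h) * (u - al) = u - h" using al u_al u_h pu unfolding h_def[symmetric] by (simp add: right_diff_distrib left_diff_distrib)
    moreover have "(u - h) * (u - h) = u - h" "u * (u - h) = u - h" "(u - h) * u = u - h"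
      using u_h hh pu unfolding h_def[symmetric] by (simp_all add: right_diff_distrib left_diff_distrib)
    ultimately have "link u (u - al) (u - h)" unfolding link_def using 1 by blast
    then show "link u (u - al) (u - (h1 + h2))" by (simp add: h_def)
  qed
qed

lemma orth_below: "below h1 e1 \<Longrightarrow> below h2 e2 \<Longrightarrow> orth e1 e2 \<Longrightarrow> orth h1 h2"
  unfolding below_def orth_def by (metis mult.assoc mult_zero_left mult_zero_right)

section \<open>Refinement and separative cancellation\<close>

locale sep_exch =
  fixes T :: "'b::stable_ring itself"
  assumes exchange: "\<And>u::'b. u * u = u \<Longrightarrow> exch u"
    and separativity: "\<And>x y::'b idem_class. x + x = x + y \<Longrightarrow> x + y = y + y \<Longrightarrow> x = y"
begin

text \<open>Both sums are realized by decompositions \<open>p + n\<close> and \<open>e1 + e2\<close>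
  of one idempotent. Exchange makes \<open>p\<close> equivalent to \<open>h1 + h2\<close>, and links
  make \<open>n\<close> equivalent to \<open>(e1 - h1) + (e2 - h2)\<close>; these four pieces are
  the refinement.\<close>

lemma refinement:
  fixes x y z w :: "'b idem_class"
  assumes "x + y = z + w"
  obtains a b c d where "x = a + b" "y = c + d" "z = a + c" "w = b + d"
proof -
  obtain e1 :: 'b where e1: "e1 * e1 = e1" "cls e1 = z" using cls_surj by blast
  obtain e2 where e2: "e2 * e2 = e2" "orth e1 e2" "cls e2 = w" using cls_surj_orth[OF e1(1)] by blast
  define u where "u = e1 + e2"
  have u: "u * u = u" "cls u = x + y"
    using idem_add[OF e1(1) e2(1,2)] cls_add[OF e1(1) e2(1,2)] e1(2) e2(3) assms
    unfolding u_def by simp_all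
  obtain p n where pn: "u = p + n" "p * p = p" "n * n = n" "orth p n" "cls p = x" "cls n = y"
    using cls_split[OF u] by blast
  obtain h1 h2 f where h: "h1 * h1 = h1" "h2 * h2 = h2" "below h1 e1" "below h2 e2" "mv p (h1 + h2)"
    "link u n f" "link u f (u - (h1 + h2))"
    using exchange_complement[OF exchange[OF pn(2)] pn(2,3) _ _ e1(1) e2(1) _ _ pn(1) u_def]
      pn(4) e2(2) unfolding orth_def by metis
  have o: "orth h1 h2" using orth_below[OF h(3,4) e2(2)] .
  have d1: "(e1 - h1) * (e1 - h1) = e1 - h1" "orth h1 (e1 - h1)" "below (e1 - h1) e1"
    using below_diff[OF e1(1) h(3) h(1)] .
  have d2: "(e2 - h2) * (e2 - h2) = e2 - h2" "orth h2 (e2 - h2)" "below (e2 - h2) e2"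
    using below_diff[OF e2(1) h(4) h(2)] .
  have o2: "orth (e1 - h1) (e2 - h2)" using orth_below[OF d1(3) d2(3) e2(2)] .
  have "mv n (u - (h1 + h2))" using h(6,7) link_mv mv_trans by blast
  moreover have "u - (h1 + h2) = (e1 - h1) + (e2 - h2)" by (simp add: u_def)
  ultimately have n: "mv n ((e1 - h1) + (e2 - h2))" by simp
  have y: "y = cls (e1 - h1) + cls (e2 - h2)"
    using n pn(3,6) d1(1) d2(1) o2 cls_eq mv_idem cls_add by metis
  have x: "x = cls h1 + cls h2" using h(1,2,5) pn(2,5) o cls_eq mv_idem cls_add by metis
  have z: "z = cls h1 + cls (e1 - h1)" using cls_add[OF h(1) d1(1,2)] e1(2) by simp
  have w: "w = cls h2 + cls (e2 - h2)" using cls_add[OF h(2) d2(1,2)] e2(3) by simp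
  show ?thesis using that x y z w .
qed

text \<open>Writing one copy of \<open>a\<close> in \<open>a + a\<close> as \<open>c + a'\<close>
  lets \<open>a + c\<close> be replaced by \<open>b + c\<close>, so \<open>a + a = a + b\<close>. By
  symmetry \<open>b + b = a + b\<close>, and separativity applies.\<close>

lemma separative_cancel:
  fixes a b c :: "'b idem_class"
  assumes "a + c = b + c" "a = c + a'" "b = c + b'"
  shows "a = b"
proof (rule separativity)
  have "a + a = (a + c) + a'" using assms(2) by (metis add.assoc)
  also have "\<dots> = b + (c + a')" by (simp add: assms(1) add.assoc)
  finally show "a + a = a + b" using assms(2) by (simp add: add.commute)
  have "b + b = (b + c) + b'" using assms(3) by (metis add.assoc)
  also have "\<dots> = a + (c + b')" by (simp add: assms(1)[symmetric] add.assoc)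
  finally show "a + b = b + b" using assms(3) by simp
qed

text \<open>\<open>K\<close>, \<open>I\<close>, \<open>C\<close> stand for kernel, image and
  cokernel. The part \<open>z\<close> shared by \<open>i1\<close> and \<open>k2\<close> changes
  blocks, so the first block becomes \<open>k1 + z\<close> and \<open>y\<close>, the second
  \<open>z'\<close> and \<open>i2 + z\<close>. What remains of \<open>I\<close> in the first block,
  \<open>y\<close>, is also a summand of \<open>i2\<close> and can therefore be cancelled.\<close>

lemma diagonal_classes:
  fixes K C I P Q P' :: "'b idem_class"
  assumes KI: "K + I = P + Q" and CI: "C + I = P + Q" and PQ: "Q = P + P'"
  obtains K1 K2 C1 C2 I1 I2 where "K = K1 + K2" "C = C1 + C2" "I = I1 + I2"
    "K1 + I1 = P" "C1 + I1 = P" "K2 + I2 = Q" "C2 + I2 = Q"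
proof -
  obtain k1 k2 i1 i2 where k: "K = k1 + k2" "I = i1 + i2" "P = k1 + i1" "Q = k2 + i2"
    using refinement[OF KI] by metis
  have "i1 + (k1 + P') = k2 + i2" using k PQ by (simp add: ac_simps)
  then obtain z y z' y' where z: "i1 = z + y" "k2 = z + z'" "i2 = y + y'"
    using refinement by metis
  have "C + (i2 + z) = (k1 + z) + Q"
  proof (rule separative_cancel)
    show "C + (i2 + z) + y = k1 + z + Q + y" using CI k(2,3) z(1) by (simp add: ac_simps)
    show "C + (i2 + z) = y + (C + (y' + z))" using z by (simp add: ac_simps)
    show "k1 + z + Q = y + (k1 + z + k2 + y')" using z k by (simp add: ac_simps)
  qed
  then obtain C1 C2 a b where c: "C = C1 + C2" "i2 + z = a + b" "k1 + z = C1 + a" "Q = C2 + b"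
    using refinement by metis
  show ?thesis
  \<comment> \<open>The kernel receives the same first summand \<open>C1\<close> as the cokernel.
    Since \<open>k1 + z = C1 + a\<close>, the class \<open>a\<close> moves from the first to the
    second block of the kernel and, in the opposite direction, from \<open>i2 + z\<close> to the
    first block of the image.\<close>
  proof (rule that[of C1 "a + z'" C1 C2 "a + y" b])
    show "K = C1 + (a + z')" using k z c by (metis add.assoc)
    show "I = a + y + b" using k(2) z(1) c(2) by (metis add.assoc add.commute)
    show "C1 + (a + y) = P" using k(3) z(1) c(3) by (metis add.assoc)
    then show "C1 + (a + y) = P" .
    have "a + z' + b = z' + (i2 + z)" using c(2) by (simp add: ac_simps)
    then show "a + z' + b = Q" using k(4) z(2) by (simp add: ac_simps)
  qed (use c in auto)
qed

end

section \<open>Trading isomorphic summands along links\<close>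

definition orth4 :: "'b::ring \<Rightarrow> 'b \<Rightarrow> 'b \<Rightarrow> 'b \<Rightarrow> 'b \<Rightarrow> bool" where
  "orth4 u a b c d \<longleftrightarrow> u = a + b + c + d \<and> a * a = a \<and> b * b = b \<and> c * c = c \<and> d * d = d \<and>
     orth a b \<and> orth a c \<and> orth a d \<and> orth b c \<and> orth b d \<and> orth c d"

text \<open>Three links suffice. Subtracting the isomorphism \<open>x\<close> from
  \<open>c + z\<close> keeps the image, and subtracting \<open>y\<close> from \<open>c + z'\<close>
  keeps the image as well; the two resulting idempotents have the same kernel.\<close>

lemma link_exchange:
  assumes o: "orth4 u c z z' d" and mv: "mv z z'"
  shows "(link u)\<^sup>*\<^sup>* (c + z) (c + z')"
proof -
  obtain x y where "mviso x y z z'" using mv mv_def by blast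
  note h = mvisoD[OF this]
  have o': "c * z = 0" "z * c = 0" "c * z' = 0" "z' * c = 0" "z * z' = 0" "z' * z = 0"
      "c * c = c" "c * d = 0" "d * c = 0" "z * d = 0" "d * z = 0" "z' * d = 0" "d * z' = 0"
    using o unfolding orth4_def orth_def by auto
  have w: "c * x = 0" "x * c = 0" "c * y = 0" "y * c = 0" "z' * x = 0" "x * z = 0" "z * y = 0" "y * z' = 0"
    "d * x = 0" "x * d = 0" "d * y = 0" "y * d = 0"
    using o' h by (blast intro: unit_trans)+
  have xx: "x * x = 0" "y * y = 0" using w h by (blast intro: unit_trans)+
  have u: "u = c + z + z' + d" using o unfolding orth4_def by auto
  note R = o' w xx h
  have "link u (c + z) (c + z - x)" unfolding link_def u by (simp add: algebra_simps R)
  moreover have "link u (c + z - x) (c + z' - y)" unfolding link_def u by (simp add: algebra_simps R)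
  moreover have "link u (c + z' - y) (c + z')" unfolding link_def u by (simp add: algebra_simps R)
  ultimately show ?thesis by (meson converse_rtranclp_into_rtranclp rtranclp.rtrancl_refl)
qed

text \<open>A summand of \<open>e\<close> and a summand of \<open>l\<close> of common class
  \<open>z\<close> are traded: the first is absorbed by \<open>k\<close>, the second by
  \<open>f\<close>. Thus \<open>e + k\<close> is preserved, while \<open>f + e\<close> changes only
  through links.\<close>

lemma orth4_split:
  assumes o: "orth4 u e k l f" and "cls e = z + y" "cls l = z + w"
  obtains e' k' l' f' where "orth4 u e' k' l' f'" "e' + k' = e + k" "cls e' = y" "cls k' = cls k + z"
    "cls l' = w" "cls f' = cls f + z" "(link u)\<^sup>*\<^sup>* (f + e) (f' + e')"
proof -
  have i: "e * e = e" "k * k = k" "l * l = l" "f * f = f" 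
    "e * k = 0" "k * e = 0" "e * l = 0" "l * e = 0" "e * f = 0" "f * e = 0"
    "k * l = 0" "l * k = 0" "k * f = 0" "f * k = 0" "l * f = 0" "f * l = 0"
    and u: "u = e + k + l + f"
    using o unfolding orth4_def orth_def by auto
  obtain a b where a: "e = a + b" "a * a = a" "b * b = b" "a * b = 0" "b * a = 0" "cls a = z" "cls b = y"
    using cls_split[OF i(1) assms(2)] unfolding orth_def by metis
  obtain c d where c: "l = c + d" "c * c = c" "d * d = d" "c * d = 0" "d * c = 0" "cls c = z" "cls d = w"
    using cls_split[OF i(3) assms(3)] unfolding orth_def by metis
  have be: "a * e = a" "e * a = a" "b * e = b" "e * b = b" "c * l = c" "l * c = c" "d * l = d" "l * d = d"
    unfolding a(1) c(1) using a c by (simp_all add: algebra_simps)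
  have j: "a * k = 0" "k * a = 0" "a * l = 0" "l * a = 0" "a * f = 0" "f * a = 0"
    "b * k = 0" "k * b = 0" "b * l = 0" "l * b = 0" "b * f = 0" "f * b = 0"
    "c * k = 0" "k * c = 0" "c * e = 0" "e * c = 0" "c * f = 0" "f * c = 0"
    "d * k = 0" "k * d = 0" "d * e = 0" "e * d = 0" "d * f = 0" "f * d = 0"
    using be i by (blast intro: unit_trans)+
  have m: "a * c = 0" "c * a = 0" "a * d = 0" "d * a = 0" "b * c = 0" "c * b = 0" "b * d = 0" "d * b = 0"
    using be j by (blast intro: unit_trans)+
  note R = i(2,4) i(13) i(14) a(2-5) c(2-5) j m
  show ?thesis
  proof (rule that[of b "k + a" d "f + c"])
    show "orth4 u b (k + a) d (f + c)"
      unfolding orth4_def orth_def u a(1) c(1) by (simp add: algebra_simps R)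
    show "b + (k + a) = e + k" using a(1) by (simp add: ac_simps)
    show "cls (k + a) = cls k + z" using cls_add[OF i(2) a(2)] a(6) j by (simp add: orth_def)
    show "cls (f + c) = cls f + z" using cls_add[OF i(4) c(2)] c(6) j by (simp add: orth_def)
    have "mv a c" using a c cls_eq by metis
    moreover have "orth4 u (f + b) a c (k + d)"
      unfolding orth4_def orth_def u a(1) c(1) by (simp add: algebra_simps R)
    ultimately have "(link u)\<^sup>*\<^sup>* (f + b + a) (f + b + c)" by (rule link_exchange[rotated])
    then show "(link u)\<^sup>*\<^sup>* (f + e) (f + c + b)" using a(1) by (simp add: ac_simps)
  qed (use a c in auto)
qed

context sep_exch
begin

text \<open>In the application \<open>e + k\<close> is the block projection \<open>p\<close> and
  \<open>l + f\<close> its complement. The trades shrink \<open>e\<close> until it is a summand of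
  both \<open>k\<close> and \<open>f\<close>; then \<open>e + k = e + f\<close> cancels, and
  \<open>f\<close> can be traded for \<open>k\<close>.\<close>

lemma link_connected:
  fixes e k l f :: 'b
  assumes o: "orth4 u e k l f" and one: "cls e + cls k = cls e + cls f" and two: "cls l + cls k = cls l + cls f"
    and three: "cls l + cls f = cls e + X"
  shows "(link u)\<^sup>*\<^sup>* (f + e) (e + k)"
proof -
  \<comment> \<open>Trading away the part \<open>z\<close> that \<open>e\<close> shares with
    \<open>l\<close> leaves \<open>y\<close>, which is a summand of \<open>f\<close>.\<close>
  obtain z y a b where r: "cls e = z + y" "X = a + b" "cls l = z + a" "cls f = y + b"
    using refinement[of "cls e" X "cls l" "cls f"] three by metis
  obtain e' k' l' f' where s: "orth4 u e' k' l' f'" "e' + k' = e + k" "cls e' = y" "cls k' = cls k + z"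
    "cls l' = a" "cls f' = cls f + z" "(link u)\<^sup>*\<^sup>* (f + e) (f' + e')"
    using orth4_split[OF o r(1,3)] by metis
  have one': "cls e' + cls k' = cls e' + cls f'" using one s r by (simp add: ac_simps)
  have "cls e' + (X + z) = cls l' + cls k'" using two three s r by (simp add: ac_simps)
  \<comment> \<open>The second trade removes the part shared with \<open>l'\<close> and leaves
    \<open>y2\<close>, which is a summand of \<open>k'\<close>. It is still one of
    \<open>f2\<close>, because \<open>f2\<close> contains \<open>y\<close>.\<close>
  then obtain z2 y2 a2 b2 where r2: "cls e' = z2 + y2" "X + z = a2 + b2" "cls l' = z2 + a2" "cls k' = y2 + b2"
    using refinement[of "cls e'" "X + z" "cls l'" "cls k'"] by metis
  obtain e2 k2 l2 f2 where s2: "orth4 u e2 k2 l2 f2" "e2 + k2 = e' + k'" "cls e2 = y2" "cls k2 = cls k' + z2"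
    "cls l2 = a2" "cls f2 = cls f' + z2" "(link u)\<^sup>*\<^sup>* (f' + e') (f2 + e2)"
    using orth4_split[OF s(1) r2(1,3)] by metis
  have "cls k2 = cls f2"
  proof (rule separative_cancel)
    show "cls k2 + cls e2 = cls f2 + cls e2" using one' s2 r2 by (simp add: ac_simps)
    show "cls k2 = cls e2 + (b2 + z2)" using s2 r2 by (simp add: ac_simps)
    have "cls f2 = y + (b + z) + z2" using s2 s r by (simp add: ac_simps)
    also have "y = y2 + z2" using s r2 by (simp add: ac_simps)
    finally show "cls f2 = cls e2 + (z2 + b + z + z2)" using s2 by (simp add: ac_simps)
  qed
  then have "mv f2 k2" using s2(1) cls_eq unfolding orth4_def by metis
  moreover have "orth4 u e2 f2 k2 l2" using s2(1) unfolding orth4_def by (auto simp: ac_simps orth_sym)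
  ultimately have "(link u)\<^sup>*\<^sup>* (e2 + f2) (e2 + k2)" by (rule link_exchange[rotated])
  then have "(link u)\<^sup>*\<^sup>* (f2 + e2) (e + k)" using s2 s by (simp add: ac_simps)
  then show ?thesis using s(7) s2(7) by (meson rtranclp_trans)
qed

text \<open>Exchanging the conjugate of \<open>q\<close> against \<open>q + p\<close> links the
  conjugate of \<open>p\<close> to the sum of a summand of \<open>q\<close> and a summand of
  \<open>p\<close>. The classes of the four pieces then satisfy the hypotheses of
  \<open>link_connected\<close>.\<close>

lemma link_conjugate:
  fixes p q U V :: 'b
  assumes p: "p * p = p" and q: "q * q = q" and pq: "p * q = 0" "q * p = 0" and u: "u = p + q"
    and U: "u * U = U" "U * u = U" "u * V = V" "V * u = V" "U * V = u" "V * U = u"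
    and le: "cls q = cls p + X"
  shows "(link u)\<^sup>*\<^sup>* (U * p * V) p"
proof -
  define p1 where "p1 = U * p * V"
  define q1 where "q1 = U * q * V"
  have up: "u * p = p" "p * u = p" "u * q = q" "q * u = q" using p q pq u by (simp_all add: algebra_simps)
  have VU: "V * (U * w) = u * w" for w using U by (simp add: mult.assoc[symmetric])
  have up2: "u * (p * w) = p * w" "u * (q * w) = q * w" "p * (p * w) = p * w" "q * (q * w) = q * w"
     "p * (q * w) = 0" "q * (p * w) = 0" for w using up p q pq by (simp_all add: mult.assoc[symmetric])
  have 1: "p1 * p1 = p1" "q1 * q1 = q1" "p1 * q1 = 0" "q1 * p1 = 0"
    unfolding p1_def q1_def by (simp_all add: mult.assoc VU up2)
  have "U * (p + q) * V = u" using U u by simp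
  then have 2: "u = q1 + p1" unfolding p1_def q1_def by (simp add: algebra_simps)
  have "mviso (U * p) (p * V) p1 p" "mviso (U * q) (q * V) q1 q"
    unfolding mviso_def p1_def q1_def using p q by (simp_all add: mult.assoc VU up up2)
  then have 3: "cls p1 = cls p" "cls q1 = cls q" using 1 p q cls_eq mv_def by metis+
  \<comment> \<open>The exchanged idempotent is the complement \<open>q1\<close>, so that
    \<open>p1\<close> takes the place of \<open>n\<close> and is the one that gets linked.\<close>
  obtain h1 h2 f where h: "h1 * h1 = h1" "h2 * h2 = h2" "below h1 q" "below h2 p" "mv q1 (h1 + h2)"
    "link u p1 f" "link u f (u - (h1 + h2))"
    using exchange_complement[OF exchange[OF 1(2)] 1(2) 1(1) 1(4,3) q p pq(2,1) 2] u
    by (metis add.commute)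
  have oqp: "orth q p" using pq by (simp add: orth_def)
  note d1 = below_diff[OF q h(3) h(1)] note d2 = below_diff[OF p h(4) h(2)]
  have bb: "below h1 q" "below h2 p" "below (q - h1) q" "below (p - h2) p" using h d1 d2 by auto
  have o: "orth h1 h2" "orth (q - h1) (p - h2)" "orth h1 (p - h2)" "orth (q - h1) h2"
    using orth_below[OF _ _ oqp] bb by blast+
  have o4: "orth4 u (p - h2) h2 h1 (q - h1)"
    unfolding orth4_def using o d1 d2 h u by (auto simp: orth_sym)
  have s: "u - (h1 + h2) = (q - h1) + (p - h2)" using u by simp
  have "mv p1 (u - (h1 + h2))" using h(6,7) link_mv mv_trans by blast
  then have "cls p1 = cls (q - h1) + cls (p - h2)"
    using s cls_eq mv_idem cls_add d1(1) d2(1) o(2) by metis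
  moreover have "cls q1 = cls h1 + cls h2"
    using h(1,2,5) cls_eq mv_idem cls_add o(1) by metis
  moreover have "cls p = cls h2 + cls (p - h2)" "cls q = cls h1 + cls (q - h1)"
    using cls_add[OF h(2) d2(1,2)] cls_add[OF h(1) d1(1,2)] by simp_all
  ultimately have c: "cls p = cls h2 + cls (p - h2)" "cls p = cls (q - h1) + cls (p - h2)"
    "cls q = cls h1 + cls (q - h1)" "cls q = cls h1 + cls h2" using 3 by simp_all
  have "(link u)\<^sup>*\<^sup>* ((q - h1) + (p - h2)) ((p - h2) + h2)"
  proof (rule link_connected[OF o4])
    show "cls (p - h2) + cls h2 = cls (p - h2) + cls (q - h1)" using c by (metis add.commute)
    show "cls h1 + cls h2 = cls h1 + cls (q - h1)" using c by metis
    show "cls h1 + cls (q - h1) = cls (p - h2) + (cls h2 + X)"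
      using c le by (metis add.assoc add.commute)
  qed
  then have "(link u)\<^sup>*\<^sup>* (u - (h1 + h2)) p" unfolding s by simp
  then show ?thesis using h(6,7) unfolding p1_def by (meson converse_rtranclp_into_rtranclp)
qed

end

text \<open>Products of block transvections with respect to $u = p + (u - p)$, together with their inverses.\<close>

inductive elem_pair :: "'b::ring \<Rightarrow> 'b \<Rightarrow> 'b \<Rightarrow> 'b \<Rightarrow> bool" for p u where
  base: "elem_pair p u u u"
| step: "elem_pair p u g h \<Longrightarrow> u * x = x \<Longrightarrow> x * u = x \<Longrightarrow> p * x = x \<and> x * p = 0 \<or> p * x = 0 \<and> x * p = x
    \<Longrightarrow> elem_pair p u (g * (u + x)) ((u - x) * h)"

section \<open>Links realized by block transvections\<close>

lemma elem_pairD: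
  assumes e: "elem_pair p u g h" and uu: "u * u = u"
  shows "u * g = g" "g * u = g" "u * h = h" "h * u = h" "g * h = u" "h * g = u"
proof -
  from e have "u * g = g \<and> g * u = g \<and> u * h = h \<and> h * u = h \<and> g * h = u \<and> h * g = u"
  proof induction
    case (step g h x)
    have xx: "x * x = 0" using step.hyps by (blast intro: unit_trans)
    have ux: "(u + x) * (u - x) = u" "(u - x) * (u + x) = u" "(u + x) * u = u + x" "u * (u - x) = u - x"
      using xx step uu by (simp_all add: algebra_simps)
    have "g * (u + x) * ((u - x) * h) = g * ((u + x) * (u - x)) * h"
      "(u - x) * h * (g * (u + x)) = (u - x) * (h * g) * (u + x)" by (simp_all only: mult.assoc)
    moreover have "u * (g * (u + x)) = u * g * (u + x)" "u * ((u - x) * h) = u * (u - x) * h"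
      by (simp_all only: mult.assoc)
    moreover have "g * (u + x) * u = g * ((u + x) * u)" "(u - x) * h * u = (u - x) * (h * u)"
      by (simp_all only: mult.assoc)
    moreover have "(u - x) * u = u - x" using step uu by (simp add: algebra_simps)
    ultimately show ?case using ux step.IH by simp
  qed (simp add: uu)
  then show "u * g = g" "g * u = g" "u * h = h" "h * u = h" "g * h = u" "h * g = u" by blast+
qed

text \<open>With \<open>g = U * p * V\<close>, the difference \<open>y = f - g\<close> has square
  zero. For equal images \<open>g * y = y\<close> and \<open>y * g = 0\<close>, and \<open>f\<close>
  is the conjugate of \<open>g\<close> by \<open>u - y\<close>; for equal kernels the roles are
  reversed and \<open>u + y\<close> conjugates. Pulling \<open>y\<close> back along \<open>U\<close>
  gives an off-diagonal block with respect to \<open>p\<close>.\<close>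

lemma link_elem:
  assumes U: "u * U = U" "U * u = U" "u * V = V" "V * u = V" "U * V = u" "V * U = u" and p: "p * u = p" "u * p = p"
    and l: "link u (U * p * V) f"
  obtains x where "u * x = x" "x * u = x" "p * x = x \<and> x * p = 0 \<or> p * x = 0 \<and> x * p = x"
    "f = U * (u + x) * p * ((u - x) * V)"
proof -
  define g where "g = U * p * V"
  have g: "link u g f" using l unfolding g_def .
  define y where "y = f - g"
  have VU: "V * (U * w) = u * w" "U * (V * w) = u * w" for w using U by (simp_all add: mult.assoc[symmetric])
  have pV: "p * V = V * g" "U * p = g * U"
    using U p unfolding g_def by (simp_all add: mult.assoc VU) (simp_all add: mult.assoc[symmetric])
  have gu: "u * g = g" "g * u = g" "u * f = f" "f * u = f" "g * g = g" "f * f = f" using g unfolding link_def by auto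
  have yu: "u * y = y" "y * u = y" unfolding y_def using gu by (simp_all add: algebra_simps)
  consider "g * f = f" "f * g = g" | "g * f = g" "f * g = f" using g unfolding link_def by blast
  then show ?thesis
  proof cases
    case 1
    have gy: "g * y = y" "y * g = 0" unfolding y_def using 1 gu by (simp_all add: algebra_simps)
    have yy: "y * y = 0" using gy by (blast intro: unit_trans)
    show ?thesis
    proof (rule that[of "- (V * y * U)"])
      show "u * - (V * y * U) = - (V * y * U)" "- (V * y * U) * u = - (V * y * U)"
        using U by (simp_all add: mult.assoc[symmetric]) (simp add: mult.assoc)
      have "p * (V * y * U) = V * y * U"
      proof -
        have "p * (V * y * U) = V * (g * y) * U" using pV by (simp add: mult.assoc[symmetric])
        then show ?thesis using gy by simp
      qed
      moreover have "V * y * U * p = 0"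
      proof -
        have "V * y * U * p = V * (y * g) * U" using pV by (simp add: mult.assoc)
        then show ?thesis using gy by simp
      qed
      ultimately show "p * - (V * y * U) = - (V * y * U) \<and> - (V * y * U) * p = 0 \<or>
         p * - (V * y * U) = 0 \<and> - (V * y * U) * p = - (V * y * U)" by simp
      have "U * (u + - (V * y * U)) = (u - y) * U"
        using U yu by (simp add: algebra_simps VU yu[THEN mult_left_absorb])
      moreover have "(u - - (V * y * U)) * V = V * (u + y)"
        using U yu by (simp add: algebra_simps VU)
      ultimately have "U * (u + - (V * y * U)) * p * ((u - - (V * y * U)) * V) = (u - y) * g * (u + y)"
        unfolding g_def by (simp only: mult.assoc)
      also have "\<dots> = f" using gy yu gu by (simp add: algebra_simps) (simp add: y_def)
      finally show "f = U * (u + - (V * y * U)) * p * ((u - - (V * y * U)) * V)" by simp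
    qed
  next
    case 2
    have gy: "g * y = 0" "y * g = y" unfolding y_def using 2 gu by (simp_all add: algebra_simps)
    have yy: "y * y = 0" using gy by (blast intro: unit_trans)
    show ?thesis
    proof (rule that[of "V * y * U"])
      show "u * (V * y * U) = V * y * U" "V * y * U * u = V * y * U"
        using U by (simp_all add: mult.assoc[symmetric]) (simp add: mult.assoc)
      have "p * (V * y * U) = 0"
      proof -
        have "p * (V * y * U) = V * (g * y) * U" using pV by (simp add: mult.assoc[symmetric])
        then show ?thesis using gy by simp
      qed
      moreover have "V * y * U * p = V * y * U"
      proof -
        have "V * y * U * p = V * (y * g) * U" using pV by (simp add: mult.assoc)
        then show ?thesis using gy by simp
      qed
      ultimately show "p * (V * y * U) = V * y * U \<and> V * y * U * p = 0 \<or>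
         p * (V * y * U) = 0 \<and> V * y * U * p = V * y * U" by simp
      have "U * (u + V * y * U) = (u + y) * U"
        using U yu by (simp add: algebra_simps VU yu[THEN mult_left_absorb])
      moreover have "(u - V * y * U) * V = V * (u - y)"
        using U yu by (simp add: algebra_simps VU)
      ultimately have "U * (u + V * y * U) * p * ((u - V * y * U) * V) = (u + y) * g * (u - y)"
        unfolding g_def by (simp only: mult.assoc)
      also have "\<dots> = f" using gy yu gu yy by (simp add: algebra_simps) (simp add: y_def)
      finally show "f = U * (u + V * y * U) * p * ((u - V * y * U) * V)" by simp
    qed
  qed
qed

text \<open>Because \<open>link_elem\<close> pulls each transvection back to the fixed decomposition
  by \<open>p\<close>, the factors accumulate to the right of \<open>U\<close> and form one product
  \<open>g\<close>.\<close>

lemma link_chain_elem: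
  assumes "(link u)\<^sup>*\<^sup>* (U * p * V) f" and uu: "u * u = u"
    and U: "u * U = U" "U * u = U" "u * V = V" "V * u = V" "U * V = u" "V * U = u" and p: "p * u = p" "u * p = p"
  shows "\<exists>g h. elem_pair p u g h \<and> f = U * g * p * (h * V)"
  using assms(1)
proof (induction rule: rtranclp_induct)
  case base
  have "U * p * V = U * u * p * (u * V)" using U by simp
  then show ?case using elem_pair.base by blast
next
  case (step f f')
  then obtain g h where g: "elem_pair p u g h" "f = U * g * p * (h * V)" by blast
  note D = elem_pairD[OF g(1) uu]
  have "link u ((U * g) * p * (h * V)) f'" using step g by simp
  moreover have "U * g * (h * V) = u" 
  proof -
    have "U * g * (h * V) = U * (g * h) * V" by (simp only: mult.assoc)
    then show ?thesis using D U by simp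
  qed
  moreover have "h * V * (U * g) = u"
  proof -
    have "h * V * (U * g) = h * (V * U) * g" by (simp only: mult.assoc)
    then show ?thesis using D U by simp
  qed
  moreover have "u * (U * g) = U * g" "U * g * u = U * g" "u * (h * V) = h * V" "h * V * u = h * V"
    using U D by (simp_all add: mult.assoc[symmetric]) (simp_all add: mult.assoc)
  ultimately obtain x where x: "u * x = x" "x * u = x" "p * x = x \<and> x * p = 0 \<or> p * x = 0 \<and> x * p = x"
    "f' = U * g * (u + x) * p * ((u - x) * (h * V))"
    using link_elem[of u "U * g" "h * V" p f'] p by metis
  have "f' = U * (g * (u + x)) * p * ((u - x) * h * V)" using x(4) by (simp only: mult.assoc)
  then show ?case using elem_pair.step[OF g(1) x(1-3)] by blast
qed

text \<open>Following the links from \<open>U * p * V\<close> to \<open>p\<close> gives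
  \<open>p = (U * g) * p * (h * V)\<close>, where \<open>h * V\<close> inverts \<open>U * g\<close>.
  Hence both commute with \<open>p\<close>, that is, they are block diagonal.\<close>

lemma (in sep_exch) unit_elem_reduce:
  fixes p q U V :: 'b
  assumes p: "p * p = p" and q: "q * q = q" and pq: "p * q = 0" "q * p = 0" and u: "u = p + q"
    and U: "u * U = U" "U * u = U" "u * V = V" "V * u = V" "U * V = u" "V * U = u"
    and le: "cls q = cls p + X"
  obtains g h where "elem_pair p u g h" "p * (U * g) = U * g * p" "p * (h * V) = h * V * p"
proof -
  have up: "u * p = p" "p * u = p" "u * u = u" using p q pq u by (simp_all add: algebra_simps)
  obtain g h where g: "elem_pair p u g h" "p = U * g * p * (h * V)"
    using link_chain_elem[OF link_conjugate[OF assms] up(3) U up(2,1)] by blast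
  note D = elem_pairD[OF g(1) up(3)]
  have 1: "h * V * (U * g) = u"
  proof -
    have "h * V * (U * g) = h * (V * U) * g" by (simp only: mult.assoc)
    then show ?thesis using D U by simp
  qed
  have "p * (U * g) = U * g * p * (h * V * (U * g))" using g(2) by (metis mult.assoc)
  also have "\<dots> = U * g * p" using 1 up by (simp add: mult.assoc)
  finally have "p * (U * g) = U * g * p" .
  moreover have "h * V * p = h * V * (U * g) * p * (h * V)" using g(2) by (metis mult.assoc)
  then have "p * (h * V) = h * V * p" using 1 up by simp
  ultimately show ?thesis using that g by blast
qed

section \<open>Block diagonalization of regular elements\<close>

context sep_exch
begin

text \<open>\<open>j\<close> and \<open>u - j\<close> split the source into a copy of the image and
  the kernel; \<open>i\<close> and \<open>u - i\<close> split the target into image and cokernel.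
  After these pieces are cut according to \<open>diagonal_classes\<close>, \<open>V\<close> maps
  \<open>p\<close> to \<open>j1 + k1\<close> and \<open>q\<close> to \<open>j2 + k2\<close>, while
  \<open>W\<close> maps \<open>i1 + c1\<close> to \<open>p\<close> and \<open>i2 + c2\<close> to
  \<open>q\<close>.\<close>

lemma regular_block_equivalent:
  fixes p q A B :: 'b
  assumes p: "p * p = p" and q: "q * q = q" and pq: "p * q = 0" "q * p = 0" and u: "u = p + q"
    and A: "u * A = A" "A * u = A" and B: "u * B = B" "B * u = B" and ABA: "A * B * A = A"
    and le: "cls q = cls p + X"
  obtains W W' V V' where "mviso W W' u u" "mviso V V' u u" "p * (W * A * V) = W * A * V * p"
proof -
  have uu: "u * u = u" using p q pq u by (simp add: algebra_simps)
  have opq: "orth p q" using pq by (simp add: orth_def)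
  \<comment> \<open>This choice makes the quasi-inverse reflexive, so that \<open>A\<close> and
    \<open>C\<close> are inverse isomorphisms between \<open>j\<close> and \<open>i\<close>.\<close>
  define C where "C = B * A * B"
  have AC: "A * C * A = A" "C * A * C = C" "u * C = C" "C * u = C"
    unfolding C_def using ABA B by (metis mult.assoc)+
  define i where "i = A * C"
  define j where "j = C * A"
  have iA: "i * A = A" "A * j = A" "j * C = C" "C * i = C" "A * C = i" "C * A = j"
    unfolding i_def j_def using AC by (simp_all add: mult.assoc)
  have m: "mviso A C i j" unfolding mviso_def using iA by blast
  have ii: "i * i = i" "j * j = j" using mvisoD[OF m] by blast+
  have iu: "i * u = i" "u * i = i" "j * u = j" "u * j = j"
    unfolding i_def j_def using A AC by (simp_all add: mult.assoc) (simp_all add: mult.assoc[symmetric])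
  have bi: "below i u" "below j u" using iu by (simp_all add: below_def)
  note di = below_diff[OF uu bi(1) ii(1)] note dj = below_diff[OF uu bi(2) ii(2)]
  have cu: "cls u = cls p + cls q" using cls_add[OF p q opq] u by simp
  have ij: "cls i = cls j" using m ii cls_eq mv_def by metis
  have KI: "cls (u - j) + cls j = cls p + cls q" and CI: "cls (u - i) + cls j = cls p + cls q"
    using cls_add[OF ii(1) di(1,2)] cls_add[OF ii(2) dj(1,2)] cu ij by (simp_all add: add.commute)
  obtain K1 K2 C1 C2 I1 I2 where s: "cls (u - j) = K1 + K2" "cls (u - i) = C1 + C2" "cls j = I1 + I2"
    "K1 + I1 = cls p" "C1 + I1 = cls p" "K2 + I2 = cls q" "C2 + I2 = cls q"
    using diagonal_classes[OF KI CI le] .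
  obtain j1 j2 where j: "j = j1 + j2" "j1 * j1 = j1" "j2 * j2 = j2" "orth j1 j2" "cls j1 = I1" "cls j2 = I2"
    using cls_split[OF ii(2) s(3)] .
  obtain k1 k2 where k: "u - j = k1 + k2" "k1 * k1 = k1" "k2 * k2 = k2" "orth k1 k2" "cls k1 = K1" "cls k2 = K2"
    using cls_split[OF dj(1) s(1)] .
  obtain c1 c2 where c: "u - i = c1 + c2" "c1 * c1 = c1" "c2 * c2 = c2" "orth c1 c2" "cls c1 = C1" "cls c2 = C2"
    using cls_split[OF di(1) s(2)] .
  have bj: "below j1 j" "below j2 j" unfolding below_def j(1) using j by (auto simp: orth_def algebra_simps)
  have bk: "below k1 (u - j)" "below k2 (u - j)" unfolding below_def k(1) using k by (auto simp: orth_def algebra_simps)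
  have bc: "below c1 (u - i)" "below c2 (u - i)" unfolding below_def c(1) using c by (auto simp: orth_def algebra_simps)
  have jj: "j1 * j2 = 0" "j2 * j1 = 0" using j by (auto simp: orth_def)
  \<comment> \<open>The splitting of \<open>j\<close> is transported by \<open>A\<close>, so that
    \<open>A\<close> carries \<open>j1\<close> to \<open>i1\<close> and \<open>j2\<close> to
    \<open>i2\<close>.\<close>
  define i1 where "i1 = A * j1 * C"
  define i2 where "i2 = A * j2 * C"
  have CA: "C * (A * w) = j * w" for w using iA by (metis mult.assoc)
  have jw: "j * (j1 * w) = j1 * w" "j * (j2 * w) = j2 * w" "j1 * (j * w) = j1 * w" "j2 * (j * w) = j2 * w" for w
    using bj unfolding below_def by (metis mult.assoc)+
  have jb: "j * j1 = j1" "j * j2 = j2" "j1 * j = j1" "j2 * j = j2" using bj unfolding below_def by auto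
  note JR = CA jw jb j(2,3) j(2,3)[THEN mult_left_absorb] jj jj[THEN mult_left_absorb]
  have i1i: "i1 * i1 = i1" "i2 * i2 = i2" "orth i1 i2"
    unfolding i1_def i2_def orth_def by (simp_all add: mult.assoc JR)
  have ci: "mviso (A * j1) (j1 * C) i1 j1" "mviso (A * j2) (j2 * C) i2 j2"
    unfolding i1_def i2_def mviso_def using iA by (simp_all add: mult.assoc JR)
  have isum: "i = i1 + i2"
  proof -
    have "A * (j1 + j2) * C = i" using iA j(1) by simp
    then show ?thesis unfolding i1_def i2_def by (simp add: algebra_simps)
  qed
  have bi12: "below i1 i" "below i2 i" unfolding below_def isum using i1i by (auto simp: orth_def algebra_simps)
  have clsi: "cls i1 = I1" "cls i2 = I2" using ci i1i j cls_eq mv_def by metis+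
  have ojk: "orth j1 k1" "orth j2 k2" "orth j1 k2" "orth j2 k1" using orth_below[OF _ _ dj(2)] bj bk by blast+
  have oic: "orth i1 c1" "orth i2 c2" "orth i1 c2" "orth i2 c1" using orth_below[OF _ _ di(2)] bi12 bc by blast+
  have jk: "(j1 + k1) * (j1 + k1) = j1 + k1" "(j2 + k2) * (j2 + k2) = j2 + k2"
     "(i1 + c1) * (i1 + c1) = i1 + c1" "(i2 + c2) * (i2 + c2) = i2 + c2"
    using j k c i1i ojk oic by (simp_all add: idem_add)
  have "cls (j1 + k1) = cls p" "cls (j2 + k2) = cls q" "cls (i1 + c1) = cls p" "cls (i2 + c2) = cls q"
    using cls_add[OF j(2) k(2) ojk(1)] cls_add[OF j(3) k(3) ojk(2)] cls_add[OF i1i(1) c(2) oic(1)]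
      cls_add[OF i1i(2) c(3) oic(2)] j k c clsi s by (simp_all add: add.commute)
  then have "mv (j1 + k1) p" "mv (j2 + k2) q" "mv p (i1 + c1)" "mv q (i2 + c2)"
    using jk p q cls_eq by metis+
  then obtain a1 b1 a2 b2 d1 f1 d2 f2 where
    ab: "mviso a1 b1 (j1 + k1) p" "mviso a2 b2 (j2 + k2) q"
    and df: "mviso d1 f1 p (i1 + c1)" "mviso d2 f2 q (i2 + c2)"
    unfolding mv_def by blast
  have o: "orth (j1 + k1) (j2 + k2)" "orth (i1 + c1) (i2 + c2)"
    using ojk oic j(4) k(4) c(4) i1i(3) unfolding orth_def by (simp_all add: algebra_simps)
  have us: "(j1 + k1) + (j2 + k2) = u" "(i1 + c1) + (i2 + c2) = u"
    using j(1) k(1) c(1) isum by (simp_all add: algebra_simps)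
  have V: "mviso (a1 + a2) (b1 + b2) u u" using mviso_add[OF ab o(1) opq] us u by simp
  have W: "mviso (d1 + d2) (f1 + f2) u u" using mviso_add[OF df opq o(2)] us u by simp
  note va = mvisoD[OF ab(1)] mvisoD[OF ab(2)] note wd = mvisoD[OF df(1)] mvisoD[OF df(2)]
  have "A * (u - j) = 0" "(u - i) * A = 0" using A iA by (simp_all add: algebra_simps)
  then have Ak: "A * k1 = 0" "A * k2 = 0" using bk unfolding below_def by (blast intro: unit_trans)+
  have Aj: "i1 * A = A * j1" "i2 * A = A * j2"
    unfolding i1_def i2_def using iA jb by (simp_all add: mult.assoc)
  have Aa: "A * a1 = i1 * (A * a1)" "A * a2 = i2 * (A * a2)"
  proof -
    have "A * a1 = A * ((j1 + k1) * a1)" "A * a2 = A * ((j2 + k2) * a2)" using va by simp_all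
    then have "A * a1 = A * j1 * a1" "A * a2 = A * j2 * a2"
      using Ak by (simp_all add: mult.assoc[symmetric] distrib_left)
    moreover have "i1 * (A * a1) = A * j1 * a1" "i2 * (A * a2) = A * j2 * a2"
      using Aj by (simp_all add: mult.assoc[symmetric])
    ultimately show "A * a1 = i1 * (A * a1)" "A * a2 = i2 * (A * a2)" by simp_all
  qed
  have oi: "(i1 + c1) * i2 = 0" "(i2 + c2) * i1 = 0" using i1i(3) oic unfolding orth_def by (simp_all add: algebra_simps)
  have di0: "d1 * i2 = 0" "d2 * i1 = 0" using oi wd by (metis mult.assoc mult_zero_right)+
  have x0: "d1 * (A * a2) = 0" "d2 * (A * a1) = 0"
    using di0 Aa by (metis mult.assoc mult_zero_left)+
  have "a2 * p = 0" "p * d2 = 0" using va wd pq by (blast intro: unit_trans)+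
  then have "p * ((d1 + d2) * A * (a1 + a2)) = (d1 + d2) * A * (a1 + a2) * p"
    using x0 va wd by (simp add: distrib_left distrib_right mult.assoc) (simp add: mult.assoc[symmetric])
  then show ?thesis using that[OF W V] by blast
qed

text \<open>The unit reduction is applied to \<open>W\<close> and to the inverse \<open>V'\<close>
  of \<open>V\<close>. Then \<open>h' * A * g\<close> is the product of the block diagonal elements
  \<open>h' * W'\<close>, \<open>W * A * V\<close> and \<open>V' * g\<close>.\<close>

lemma regular_block_reduce:
  fixes p q A B :: 'b
  assumes p: "p * p = p" and q: "q * q = q" and pq: "p * q = 0" "q * p = 0" and u: "u = p + q"
    and A: "u * A = A" "A * u = A" and B: "u * B = B" "B * u = B" and ABA: "A * B * A = A"
    and le: "cls q = cls p + X"
  obtains g h g' h' where "elem_pair p u g h" "elem_pair p u g' h'" "p * (h' * A * g) = h' * A * g * p"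
proof -
  have uu: "u * u = u" "p * u = p" "u * p = p" using p q pq u by (simp_all add: algebra_simps)
  obtain W W' V V' where W: "mviso W W' u u" and V: "mviso V V' u u" and c: "p * (W * A * V) = W * A * V * p"
    using regular_block_equivalent[OF assms] .
  note w = mvisoD[OF W] note v = mvisoD[OF V]
  obtain g h where g: "elem_pair p u g h" "p * (V' * g) = V' * g * p" "p * (h * V) = h * V * p"
    using unit_elem_reduce[OF p q pq u v(3,4,1,2,6,5) le] .
  obtain g' h' where g': "elem_pair p u g' h'" "p * (W * g') = W * g' * p" "p * (h' * W') = h' * W' * p"
    using unit_elem_reduce[OF p q pq u w(1,2,3,4,5,6) le] .
  note G = elem_pairD[OF g(1) uu(1)] elem_pairD[OF g'(1) uu(1)]
  have e: "h' * A * g = (h' * W') * ((W * A * V) * (V' * g))"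
  proof -
    have "(h' * W') * ((W * A * V) * (V' * g)) = h' * (W' * W) * A * (V * V') * g" by (simp only: mult.assoc)
    also have "\<dots> = h' * A * g" using w v G A by (simp add: mult.assoc)
    finally show ?thesis by simp
  qed
  have "p * (a * b) = a * b * p" if "p * a = a * p" "p * b = b * p" for a b
    using that by (metis mult.assoc)
  then have "p * (h' * A * g) = h' * A * g * p" unfolding e using g g' c by blast
  then show ?thesis using that g g' by blast
qed

end

section \<open>Diagonal matrix units and induction on the size\<close>

locale frame = sep_exch T for T :: "'b::stable_ring itself" +
  fixes d :: "nat \<Rightarrow> 'b"
  assumes d_idem: "d i * d i = d i" and d_orth: "i \<noteq> j \<Longrightarrow> d i * d j = 0" and d_mv: "mv (d i) (d j)"
begin

definition unit_sum :: "nat \<Rightarrow> 'b" where "unit_sum n = (\<Sum>i<n. d i)"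

text \<open>An element with \<open>d i * x = x\<close> and \<open>x * d j = x\<close> plays the role
  of a multiple of a matrix unit, so the two alternatives are multiplication by a transvection,
  written without entries.\<close>

definition estep :: "nat \<Rightarrow> 'b \<Rightarrow> 'b \<Rightarrow> bool" where
  "estep n A B \<longleftrightarrow> (\<exists>i j x. i < n \<and> j < n \<and> i \<noteq> j \<and> d i * x = x \<and> x * d j = x \<and> (B = A + x * A \<or> B = A + A * x))"

lemma d_unit_sum: "d i * unit_sum n = (if i < n then d i else 0)" "unit_sum n * d i = (if i < n then d i else 0)"
proof -
  have "d i * unit_sum n = (\<Sum>j<n. if j = i then d i else 0)"
    unfolding unit_sum_def sum_distrib_left by (rule sum.cong) (auto simp: d_idem d_orth)
  then show "d i * unit_sum n = (if i < n then d i else 0)" by simp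
  have "unit_sum n * d i = (\<Sum>j<n. if j = i then d i else 0)"
    unfolding unit_sum_def sum_distrib_right by (rule sum.cong) (auto simp: d_idem d_orth)
  then show "unit_sum n * d i = (if i < n then d i else 0)" by simp
qed

lemma unit_sum_idem: "unit_sum n * unit_sum n = unit_sum n"
proof -
  have "unit_sum n * unit_sum n = (\<Sum>i<n. unit_sum n * d i)" 
    by (subst (2) unit_sum_def) (simp add: sum_distrib_left)
  also have "\<dots> = unit_sum n" by (simp add: d_unit_sum) (simp add: unit_sum_def)
  finally show ?thesis .
qed

lemma unit_sum_Suc: "unit_sum (Suc n) = d n + unit_sum n"
  by (simp add: unit_sum_def add.commute)

text \<open>When all products of the \<open>x k\<close> vanish, multiplying the factors 1 +
  \<open>x k\<close> simply adds the \<open>x k\<close>, so one elementary step per summand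
  suffices.\<close>

lemma esteps_sum:
  fixes m n :: nat and i j :: "nat \<Rightarrow> nat" and x :: "nat \<Rightarrow> 'b" and A :: 'b
  assumes el: "\<And>k. k < m \<Longrightarrow> i k < n \<and> j k < n \<and> i k \<noteq> j k \<and> d (i k) * x k = x k \<and> x k * d (j k) = x k"
    and z: "\<And>k l. k < m \<Longrightarrow> l < m \<Longrightarrow> x k * x l = 0"
  shows "(estep n)\<^sup>*\<^sup>* A (A + (\<Sum>k<m. x k) * A) \<and> (estep n)\<^sup>*\<^sup>* A (A + A * (\<Sum>k<m. x k))"
  using assms
proof (induction m)
  case (Suc m)
  define s where "s = (\<Sum>k<m. x k)"
  have s: "x m * s = 0" "s * x m = 0"
    unfolding s_def sum_distrib_left sum_distrib_right using Suc.prems(2) by (simp_all add: sum.neutral)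
  have 1: "(estep n)\<^sup>*\<^sup>* A (A + s * A)" "(estep n)\<^sup>*\<^sup>* A (A + A * s)"
    using Suc.IH Suc.prems unfolding s_def by (meson less_SucI)+
  have m: "m < Suc m" by simp
  have "estep n (A + s * A) ((A + s * A) + x m * (A + s * A))"
    "estep n (A + A * s) ((A + A * s) + (A + A * s) * x m)"
    unfolding estep_def using Suc.prems(1)[OF m] by blast+
  moreover have "x m * (s * A) = 0" using s by (simp add: mult.assoc[symmetric])
  ultimately have "estep n (A + s * A) (A + (s + x m) * A)" "estep n (A + A * s) (A + A * (s + x m))"
    using s by (simp_all add: algebra_simps)
  then show ?case using 1 by (simp add: s_def[symmetric]) (meson rtranclp.rtrancl_into_rtrancl)
qed simp

text \<open>A block transvection relative to \<open>d n\<close> has its off-diagonal part in a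
  single row or column. Cutting it into entries gives summands with vanishing products, as
  \<open>esteps_sum\<close> requires.\<close>

lemma esteps_offdiag:
  assumes u: "unit_sum (Suc n) * x = x" "x * unit_sum (Suc n) = x"
    and x: "d n * x = x \<and> x * d n = 0 \<or> d n * x = 0 \<and> x * d n = x"
  shows "(estep (Suc n))\<^sup>*\<^sup>* A (A + x * A)" "(estep (Suc n))\<^sup>*\<^sup>* A (A + A * x)"
proof -
  have xx: "x * x = 0" using x by (blast intro: unit_trans)
  have "(estep (Suc n))\<^sup>*\<^sup>* A (A + x * A) \<and> (estep (Suc n))\<^sup>*\<^sup>* A (A + A * x)"
    using x
  proof
    assume h: "d n * x = x \<and> x * d n = 0"
    have "x = x * (d n + unit_sum n)" using u unit_sum_Suc by simp
    then have "x = x * unit_sum n" using h by (simp add: distrib_left)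
    then have s: "x = (\<Sum>k<n. x * d k)" by (simp add: unit_sum_def sum_distrib_left)
    have "x * d k * (x * d l) = 0" if "k < n" for k l
    proof -
      have "d k * x = 0" using h d_orth[of k n] that by (metis left_zero_trans nat_neq_iff)
      then show ?thesis by (simp add: mult.assoc) (simp add: mult.assoc[symmetric])
    qed
    then show ?thesis using esteps_sum[of n "\<lambda>_. n" "Suc n" "\<lambda>k. k" "\<lambda>k. x * d k" A] s h
      by (simp add: mult.assoc d_idem) (simp add: mult.assoc[symmetric])
  next
    assume h: "d n * x = 0 \<and> x * d n = x"
    have "x = (d n + unit_sum n) * x" using u unit_sum_Suc by simp
    then have "x = unit_sum n * x" using h by (simp add: distrib_right)
    then have s: "x = (\<Sum>k<n. d k * x)" by (simp add: unit_sum_def sum_distrib_right)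
    have "d k * x * (d l * x) = 0" if "l < n" for k l
    proof -
      have "x * d l = 0" using h d_orth[of n l] that by (metis right_zero_trans nat_neq_iff)
      then show ?thesis by (simp add: mult.assoc[symmetric]) (simp add: mult.assoc)
    qed
    then show ?thesis using esteps_sum[of n "\<lambda>k. k" "Suc n" "\<lambda>_. n" "\<lambda>k. d k * x" A] s h
      by (simp add: mult.assoc[symmetric] d_idem) (simp add: mult.assoc)
  qed
  then show "(estep (Suc n))\<^sup>*\<^sup>* A (A + x * A)" "(estep (Suc n))\<^sup>*\<^sup>* A (A + A * x)" by auto
qed

lemma esteps_elem_pair:
  assumes "elem_pair (d n) (unit_sum (Suc n)) g h" "unit_sum (Suc n) * A = A" "A * unit_sum (Suc n) = A"
  shows "(estep (Suc n))\<^sup>*\<^sup>* A (A * g)" "(estep (Suc n))\<^sup>*\<^sup>* A (h * A)"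
proof -
  define u where "u = unit_sum (Suc n)"
  note uu = unit_sum_idem[of "Suc n"]
  have "(estep (Suc n))\<^sup>*\<^sup>* A (A * g) \<and> (estep (Suc n))\<^sup>*\<^sup>* A (h * A)"
    using assms(1)
  proof induction
    case base
    then show ?case using assms by simp
  next
    case (step g h x)
    note D = elem_pairD[OF step.hyps(1) uu]
    have "A * (g * (u + x)) = A * g + (A * g) * x" using D unfolding u_def by (simp add: distrib_left mult.assoc)
    moreover have "(u - x) * h * A = h * A + (- x) * (h * A)" using D unfolding u_def by (simp add: left_diff_distrib mult.assoc)
    moreover have "(estep (Suc n))\<^sup>*\<^sup>* (A * g) (A * g + (A * g) * x)"
      using esteps_offdiag[OF step.hyps(2-4)] by blast
    moreover have "(estep (Suc n))\<^sup>*\<^sup>* (h * A) (h * A + (- x) * (h * A))"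
      using esteps_offdiag(1)[of n "- x"] step.hyps(2-4) by simp
    ultimately show ?case using step.IH unfolding u_def by (metis rtranclp_trans)
  qed
  then show "(estep (Suc n))\<^sup>*\<^sup>* A (A * g)" "(estep (Suc n))\<^sup>*\<^sup>* A (h * A)" by auto
qed

text \<open>This embeds the steps supplied by the induction hypothesis into the next size: they
  annihilate \<open>Y\<close> on both sides and leave that block untouched.\<close>

lemma esteps_corner:
  assumes "(estep n)\<^sup>*\<^sup>* A B" "unit_sum n * A = A" "A * unit_sum n = A"
    and Y: "unit_sum n * Y = 0" "Y * unit_sum n = 0"
  shows "(estep (Suc n))\<^sup>*\<^sup>* (Y + A) (Y + B) \<and> unit_sum n * B = B \<and> B * unit_sum n = B"
  using assms(1)
proof (induction rule: rtranclp_induct)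
  case base
  then show ?case using assms by simp
next
  case (step B B')
  obtain i j x where x: "i < n" "j < n" "i \<noteq> j" "d i * x = x" "x * d j = x" "B' = B + x * B \<or> B' = B + B * x"
    using step(2) unfolding estep_def by blast
  have ux: "unit_sum n * x = x" "x * unit_sum n = x"
    using x d_unit_sum by (metis left_unit_trans, metis right_unit_trans)
  have 0: "x * Y = 0" "Y * x = 0" using Y ux by (metis mult.assoc mult_zero_left mult_zero_right)+
  have "Y + B' = (Y + B) + x * (Y + B) \<or> Y + B' = (Y + B) + (Y + B) * x"
    using x(6) 0 by (auto simp: algebra_simps)
  then have "estep (Suc n) (Y + B) (Y + B')" unfolding estep_def using x less_SucI by blast
  moreover have "unit_sum n * (x * B) = x * B" "B * x * unit_sum n = B * x" "unit_sum n * (B * x) = B * x" "x * B * unit_sum n = x * B"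
    using ux step.IH by (simp_all add: mult.assoc[symmetric]) (simp_all add: mult.assoc)
  then have "unit_sum n * B' = B'" "B' * unit_sum n = B'"
    using x(6) step.IH by (auto simp: distrib_left distrib_right)
  ultimately show ?case using step.IH by (meson rtranclp.rtrancl_into_rtrancl)
qed

theorem regular_diagonalizable:
  assumes "unit_sum n * A = A" "A * unit_sum n = A" "unit_sum n * B = B" "B * unit_sum n = B" "A * B * A = A"
  shows "\<exists>D. (estep n)\<^sup>*\<^sup>* A D \<and> (\<forall>i<n. \<forall>j<n. i \<noteq> j \<longrightarrow> d i * D * d j = 0)"
  using assms
proof (induction n arbitrary: A B)
  case 0
  then show ?case by blast
next
  case (Suc n)
  define p where "p = d n"
  define q where "q = unit_sum n"
  define u where "u = unit_sum (Suc n)"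
  show ?case
  proof (cases "n = 0")
    case True
    then show ?thesis by auto
  next
    case False
    have pq: "p * p = p" "q * q = q" "p * q = 0" "q * p = 0" "u = p + q"
      unfolding p_def q_def u_def by (simp_all add: d_idem unit_sum_idem d_unit_sum unit_sum_Suc)
    have uu: "u * u = u" using unit_sum_idem unfolding u_def .
    have up: "u * p = p" "p * u = p" "u * q = q" "q * u = q" using pq by (simp_all add: algebra_simps)
    \<comment> \<open>For positive \<open>n\<close> the block \<open>q\<close> contains
      \<open>d 0\<close>, a copy of \<open>p\<close>, so the class of \<open>p\<close> is a summand
      of that of \<open>q\<close>. The excluded case has size one and is diagonal already.\<close>
    have "below (d 0) q" using False by (simp add: below_def q_def d_unit_sum)
    then have "cls q = cls (d 0) + cls (q - d 0)"
      using below_diff[OF pq(2) _ d_idem] cls_add[of "d 0" "q - d 0"] d_idem by simp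
    moreover have "cls (d 0) = cls p" unfolding p_def using cls_eq d_idem d_mv by metis
    ultimately have le: "cls q = cls p + cls (q - d 0)" by simp
    note A = Suc.prems[folded u_def]
    obtain g h g' h' where g: "elem_pair p u g h" "elem_pair p u g' h'" "p * (h' * A * g) = h' * A * g * p"
      using regular_block_reduce[OF pq A le] .
    note G = elem_pairD[OF g(1) uu] elem_pairD[OF g(2) uu]
    define M where "M = h' * A * g"
    \<comment> \<open>The transvection products cancel in \<open>M * N * M\<close>, so
      \<open>M\<close> inherits a quasi-inverse from \<open>A\<close>.\<close>
    define N where "N = h * B * g'"
    have uM: "u * M = M" "M * u = M" unfolding M_def using G by (simp_all add: mult.assoc) (simp_all add: mult.assoc[symmetric])
    have AM: "(estep (Suc n))\<^sup>*\<^sup>* A M"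
    proof -
      have "(estep (Suc n))\<^sup>*\<^sup>* A (h' * A)" using esteps_elem_pair(2) g(2) A unfolding p_def u_def by blast
      moreover have "u * (h' * A) = h' * A" "h' * A * u = h' * A" using G A by (simp_all add: mult.assoc) (simp_all add: mult.assoc[symmetric])
      then have "(estep (Suc n))\<^sup>*\<^sup>* (h' * A) (h' * A * g)" using esteps_elem_pair(1) g(1) unfolding p_def u_def by blast
      ultimately show ?thesis unfolding M_def by simp
    qed
    have MNM: "M * N * M = M"
    proof -
      have "M * N * M = h' * A * (g * h) * B * (g' * h') * A * g" unfolding M_def N_def by (simp only: mult.assoc)
      also have "\<dots> = h' * (A * B * A) * g" using G A by (simp add: mult.assoc)
      finally show ?thesis using A M_def by simp
    qed
    have pM: "p * M = M * p" using g(3) M_def by simp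
    have M: "M = p * M + q * M" "M = M * p + M * q" using uM pq by (simp_all add: algebra_simps)
    have qM: "q * M = M * q" using pM M by (metis add_left_cancel)
    \<comment> \<open>The lower block of the block diagonal \<open>M\<close>. Since \<open>M\<close>
      commutes with \<open>q\<close>, it is regular with quasi-inverse \<open>q * N * q\<close>, and
      the induction hypothesis applies.\<close>
    define A' where "A' = q * M"
    have "q * M * q = q * M" using pq(2) qM by (metis mult.assoc)
    then have "q * A' = A'" "A' * q = A'" "q * (q * N * q) = q * N * q" "q * N * q * q = q * N * q"
      unfolding A'_def using pq(2) by (simp_all add: mult.assoc mult_left_absorb[OF pq(2)])
    moreover have "A' * (q * N * q) * A' = A'"
    proof -
      have "A' * (q * N * q) * A' = (q * M * q) * N * (q * q * M)" unfolding A'_def by (simp only: mult.assoc)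
      also have "\<dots> = (q * M) * N * (M * q)" using qM pq by (metis mult.assoc)
      also have "\<dots> = q * (M * N * M) * q" by (simp only: mult.assoc)
      also have "\<dots> = A'" using MNM qM pq unfolding A'_def by (metis mult.assoc)
      finally show ?thesis .
    qed
    ultimately obtain D' where D: "(estep n)\<^sup>*\<^sup>* A' D'" "\<forall>i<n. \<forall>j<n. i \<noteq> j \<longrightarrow> d i * D' * d j = 0"
      using Suc.IH[of A' "q * N * q"] unfolding q_def by blast
    have "q * A' = A'" "A' * q = A'" unfolding A'_def using pq qM by (metis mult.assoc)+
    moreover have "q * (p * M) = 0" "p * M * q = 0" using pM pq(3,4) by (metis mult.assoc mult_zero_left mult_zero_right)+
    ultimately have c: "(estep (Suc n))\<^sup>*\<^sup>* (p * M + A') (p * M + D')" "q * D' = D'" "D' * q = D'"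
      using esteps_corner[OF D(1), of "p * M"] unfolding q_def by blast+
    have "d i * (p * M + D') * d j = 0" if "i < Suc n" "j < Suc n" "i \<noteq> j" for i j
    proof -
      have 1: "d i * (p * M) * d j = 0"
      proof (cases "i = n")
        case True
        then have "p * d j = 0" unfolding p_def using that d_orth by metis
        then show ?thesis using pM by (simp add: mult.assoc)
      next
        case False
        then have "d i * p = 0" unfolding p_def using d_orth by metis
        then show ?thesis by (simp add: mult.assoc[symmetric])
      qed
      have 2: "d i * D' * d j = 0"
      proof -
        consider "i = n" | "j = n" | "i < n" "j < n" using \<open>i < Suc n\<close> \<open>j < Suc n\<close> by linarith
        then show ?thesis
        proof cases
          case 1
          then have "d i * D' = 0" using c(2) d_unit_sum(1)[of n n] unfolding q_def by (metis left_zero_trans less_irrefl)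
          then show ?thesis by simp
        next
          case 2
          then have "D' * d j = 0" using c(3) d_unit_sum(2)[of n n] unfolding q_def by (metis right_zero_trans less_irrefl)
          then show ?thesis by (simp add: mult.assoc)
        next
          case 3
          then show ?thesis using D(2) \<open>i \<noteq> j\<close> by blast
        qed
      qed
      show ?thesis using 1 2 by (simp add: distrib_left distrib_right)
    qed
    moreover have "(estep (Suc n))\<^sup>*\<^sup>* A (p * M + D')" using AM c(1) M(1) unfolding A'_def by simp
    ultimately show ?thesis by blast
  qed
qed

end

section \<open>Finite matrices over the base ring\<close>

definition bounded_by :: "nat \<Rightarrow> (nat \<Rightarrow> nat \<Rightarrow> 'a::zero) \<Rightarrow> bool" where
  "bounded_by N f \<longleftrightarrow> (\<forall>i j. N \<le> i \<or> N \<le> j \<longrightarrow> f i j = 0)"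

lemma bounded_by_mono: "bounded_by N f \<Longrightarrow> N \<le> M \<Longrightarrow> bounded_by M f"
  by (auto simp: bounded_by_def)

text \<open>The type of infinite matrices with finitely many nonzero entries contains all matrix
  rings over the base ring as corners.\<close>

typedef (overloaded) 'a fmat = "{f :: nat \<Rightarrow> nat \<Rightarrow> 'a::zero. \<exists>N. bounded_by N f}"
  morphisms ent Abs_fmat
  by (rule exI[of _ "\<lambda>_ _. 0"]) (auto simp: bounded_by_def)

setup_lifting type_definition_fmat

lemma fmat_eqI: "(\<And>i j. ent f i j = ent g i j) \<Longrightarrow> f = g"
  by (metis ent_inject ext)

lemma ex_bounded: "\<exists>N. bounded_by N (ent f)"
  using ent by auto

lemma ex_bounded2: obtains N where "bounded_by N (ent f)" "bounded_by N (ent g)"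
  using ex_bounded[of f] ex_bounded[of g] bounded_by_mono by (metis nat_le_linear)

lemma ent_Abs: "bounded_by N f \<Longrightarrow> ent (Abs_fmat f) = f"
  by (rule Abs_fmat_inverse) auto

instantiation fmat :: (ring_1) ring
begin

lift_definition zero_fmat :: "'a fmat" is "\<lambda>_ _. 0"
  by (auto simp: bounded_by_def)

lift_definition plus_fmat :: "'a fmat \<Rightarrow> 'a fmat \<Rightarrow> 'a fmat" is "\<lambda>f g i j. f i j + g i j"
proof -
  fix f g :: "nat \<Rightarrow> nat \<Rightarrow> 'a" assume "\<exists>N. bounded_by N f" "\<exists>N. bounded_by N g"
  then obtain N M where "bounded_by N f" "bounded_by M g" by blast
  then have "bounded_by (max N M) (\<lambda>i j. f i j + g i j)" by (auto simp: bounded_by_def)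
  then show "\<exists>N. bounded_by N (\<lambda>i j. f i j + g i j)" by blast
qed

lift_definition uminus_fmat :: "'a fmat \<Rightarrow> 'a fmat" is "\<lambda>f i j. - f i j"
  by (auto simp: bounded_by_def)

definition minus_fmat :: "'a fmat \<Rightarrow> 'a fmat \<Rightarrow> 'a fmat" where "f - g = f + - g" for f g :: "'a fmat"

text \<open>The sum runs over the support of a row because a bound is not part of the data;
  \<open>ent_times\<close> converts it to an initial segment for any bound.\<close>

lift_definition times_fmat :: "'a fmat \<Rightarrow> 'a fmat \<Rightarrow> 'a fmat" is
  "\<lambda>f g i j. \<Sum>k | f i k \<noteq> 0. f i k * g k j"
proof -
  fix f g :: "nat \<Rightarrow> nat \<Rightarrow> 'a" assume "\<exists>N. bounded_by N f" "\<exists>N. bounded_by N g"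
  then obtain N M where "bounded_by N f" "bounded_by M g" by blast
  then have "bounded_by (max N M) (\<lambda>i j. \<Sum>k | f i k \<noteq> 0. f i k * g k j)" by (auto simp: bounded_by_def)
  then show "\<exists>N. bounded_by N (\<lambda>i j. \<Sum>k | f i k \<noteq> 0. f i k * g k j)" by blast
qed

lemma ent_times:
  assumes "bounded_by N (ent f) \<or> bounded_by N (ent g)"
  shows "ent (f * g) i j = (\<Sum>k<N. ent f i k * ent g k j)"
proof -
  obtain M where M: "bounded_by M (ent f)" using ex_bounded by blast
  have "ent (f * g) i j = (\<Sum>k | ent f i k \<noteq> 0. ent f i k * ent g k j)" by transfer simp
  also have "\<dots> = (\<Sum>k<max M N. ent f i k * ent g k j)"
    by (rule sum.mono_neutral_left) (use M in \<open>auto simp: bounded_by_def not_le[symmetric]\<close>)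
  also have "\<dots> = (\<Sum>k<N. ent f i k * ent g k j)"
    by (rule sum.mono_neutral_right) (use assms in \<open>auto simp: bounded_by_def\<close>)
  finally show ?thesis .
qed

instance
proof
  fix f g h :: "'a fmat"
  show "f + g + h = f + (g + h)" by transfer (simp add: add.assoc)
  show "f + g = g + f" by transfer (simp add: add.commute)
  show "0 + f = f" by transfer simp
  show "- f + f = 0" by transfer simp
  show "f - g = f + - g" by (rule minus_fmat_def)
  have ent_plus: "ent (f + g) i j = ent f i j + ent g i j" for f g :: "'a fmat" and i j by transfer simp
  obtain N where N: "bounded_by N (ent f)" "bounded_by N (ent g)" by (rule ex_bounded2)
  obtain M where M: "bounded_by M (ent h)" using ex_bounded by blast
  show "f * g * h = f * (g * h)"
  proof (rule fmat_eqI)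
    fix i j
    have "ent (f * g * h) i j = (\<Sum>k<M. \<Sum>l<N. ent f i l * ent g l k * ent h k j)"
      using N M by (simp add: ent_times[of M "f * g" h] ent_times[of N f g] sum_distrib_right)
    also have "\<dots> = (\<Sum>l<N. \<Sum>k<M. ent f i l * ent g l k * ent h k j)" by (rule sum.swap)
    also have "\<dots> = ent (f * (g * h)) i j"
      using N M by (simp add: ent_times[of M g h] ent_times[of N f] sum_distrib_left mult.assoc)
    finally show "ent (f * g * h) i j = ent (f * (g * h)) i j" .
  qed
  show "(f + g) * h = f * h + g * h"
    using M by (intro fmat_eqI) (simp add: ent_plus ent_times[of M _ h] sum.distrib distrib_right)
  show "h * (f + g) = h * f + h * g" for h
  proof -
    obtain M where M: "bounded_by M (ent h)" using ex_bounded by blast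
    then show ?thesis by (intro fmat_eqI) (simp add: ent_plus ent_times[of M h] sum.distrib distrib_left)
  qed
qed

end

lemma ent_simps [simp]:
  "ent (0 :: 'a::ring_1 fmat) i j = 0"
  "ent (f + g) i j = ent f i j + ent (g :: 'a fmat) i j"
  "ent (f - g) i j = ent f i j - ent (g :: 'a fmat) i j"
  by (transfer, simp, transfer, simp, unfold minus_fmat_def, transfer, simp)

section \<open>Units, matrix units and shifts\<close>

definition fid :: "nat \<Rightarrow> 'a::ring_1 fmat" where
  "fid n = Abs_fmat (\<lambda>i j. if i = j \<and> i < n then 1 else 0)"

definition single :: "nat \<Rightarrow> nat \<Rightarrow> 'a::ring_1 \<Rightarrow> 'a fmat" where
  "single a b r = Abs_fmat (\<lambda>i j. if i = a \<and> j = b then r else 0)"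

text \<open>The shift moving the first \<open>k\<close> coordinates past the first \<open>m\<close>;
  \<open>lower\<close> undoes it. Conjugation by them places a copy of one matrix beyond the support
  of another.\<close>

definition raise :: "nat \<Rightarrow> nat \<Rightarrow> 'a::ring_1 fmat" where
  "raise m k = Abs_fmat (\<lambda>i j. if i = m + j \<and> j < k then 1 else 0)"

definition lower :: "nat \<Rightarrow> nat \<Rightarrow> 'a::ring_1 fmat" where
  "lower m k = Abs_fmat (\<lambda>i j. if j = m + i \<and> i < k then 1 else 0)"

lemma ent_fid: "ent (fid n) i j = (if i = j \<and> i < n then 1 else 0)"
  unfolding fid_def by (subst ent_Abs[of n]) (auto simp: bounded_by_def)

lemma ent_single: "ent (single a b r) i j = (if i = a \<and> j = b then r else 0)"
  unfolding single_def by (subst ent_Abs[of "Suc (max a b)"]) (auto simp: bounded_by_def)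

lemma ent_raise: "ent (raise m k) i j = (if i = m + j \<and> j < k then 1 else 0)"
  unfolding raise_def by (subst ent_Abs[of "m + k"]) (auto simp: bounded_by_def)

lemma ent_lower: "ent (lower m k) i j = (if j = m + i \<and> i < k then 1 else 0)"
  unfolding lower_def by (subst ent_Abs[of "m + k"]) (auto simp: bounded_by_def)

lemma sum_if_single:
  fixes n :: nat
  assumes "\<And>k. k < n \<Longrightarrow> k \<noteq> a \<Longrightarrow> f k = (0::'a::comm_monoid_add)" "n \<le> a \<Longrightarrow> f a = 0"
  shows "(\<Sum>k<n. f k) = f a"
proof (cases "a < n")
  case True
  then have "(\<Sum>k<n. f k) = (\<Sum>k\<in>{a}. f k)" by (intro sum.mono_neutral_right) (use assms in auto)
  then show ?thesis by simp
next
  case False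
  then show ?thesis using assms by (simp add: sum.neutral)
qed

lemma ent_mult_left_single:
  assumes "\<And>k. k \<noteq> a \<Longrightarrow> ent f i k = 0"
  shows "ent (f * g) i j = ent f i a * ent g a j"
proof -
  obtain N where N: "bounded_by N (ent f)" using ex_bounded by blast
  show ?thesis unfolding ent_times[OF disjI1[OF N]]
    by (rule sum_if_single) (use assms N in \<open>auto simp: bounded_by_def\<close>)
qed

lemma ent_mult_right_single:
  assumes "\<And>k. k \<noteq> a \<Longrightarrow> ent g k j = 0"
  shows "ent (f * g) i j = ent f i a * ent g a j"
proof -
  obtain N where N: "bounded_by N (ent f)" using ex_bounded by blast
  show ?thesis unfolding ent_times[OF disjI1[OF N]]
    by (rule sum_if_single) (use assms N in \<open>auto simp: bounded_by_def\<close>)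
qed

lemma ent_fid_mult: "ent (fid n * f) i j = (if i < n then ent f i j else 0)"
  by (subst ent_mult_left_single[of i]) (auto simp: ent_fid)

lemma ent_mult_fid: "ent (f * fid n) i j = (if j < n then ent f i j else 0)"
  by (subst ent_mult_right_single[of j]) (auto simp: ent_fid)

lemma ent_single_mult: "ent (single a b r * f) i j = (if i = a then r * ent f b j else 0)"
  by (subst ent_mult_left_single[of b]) (auto simp: ent_single)

lemma ent_mult_single: "ent (f * single a b r) i j = (if j = b then ent f i a * r else 0)"
  by (subst ent_mult_right_single[of a]) (auto simp: ent_single)

lemma ent_raise_mult: "ent (raise m k * f) i j = (if m \<le> i \<and> i < m + k then ent f (i - m) j else 0)"
  by (subst ent_mult_left_single[of "i - m"]) (auto simp: ent_raise)

lemma ent_mult_lower: "ent (f * lower m k) i j = (if m \<le> j \<and> j < m + k then ent f i (j - m) else 0)"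
  by (subst ent_mult_right_single[of "j - m"]) (auto simp: ent_lower)

lemma ent_lower_mult: "ent (lower m k * f) i j = (if i < k then ent f (m + i) j else 0)"
  by (subst ent_mult_left_single[of "m + i"]) (auto simp: ent_lower)

lemma ent_mult_raise: "ent (f * raise m k) i j = (if j < k then ent f i (m + j) else 0)"
  by (subst ent_mult_right_single[of "m + j"]) (auto simp: ent_raise)

lemma single_mult_single: "single a b r * single c e s = (if b = c then single a e (r * s) else 0)"
  by (rule fmat_eqI) (auto simp: ent_single_mult ent_single)

lemma lower_raise: "lower m k * raise m k = fid k"
  by (rule fmat_eqI) (auto simp: ent_lower_mult ent_raise ent_fid)

lemma fid_absorb:
  assumes "bounded_by n (ent f)"
  shows "fid n * f = f" "f * fid n = f"
  using assms by (auto intro!: fmat_eqI simp: ent_fid_mult ent_mult_fid bounded_by_def)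

text \<open>The copy \<open>g\<close> occupies the coordinates from \<open>m\<close> to
  \<open>m + k - 1\<close>, disjoint from the support of \<open>e\<close>. It serves both for
  \<open>stable_ring\<close> and as the lower block of \<open>dsum_mat\<close>.\<close>

lemma shift_copy:
  fixes e f :: "'a::ring_1 fmat"
  assumes e: "bounded_by m (ent e)" and f: "bounded_by k (ent f)" "f * f = f"
  defines "g \<equiv> raise m k * f * lower m k"
  shows "orth e g" "mv f g"
proof -
  have er: "e * raise m k = 0" "lower m k * e = 0"
    using e by (auto intro!: fmat_eqI simp: ent_mult_raise ent_lower_mult bounded_by_def)
  show "orth e g" unfolding orth_def g_def
    by (simp add: mult.assoc er mult_left_absorb[OF er(1)])
  note L = mult_left_absorb[OF lower_raise]
  have "mviso (f * lower m k) (raise m k * f) f g"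
    unfolding mviso_def g_def using fid_absorb[OF f(1)] f(2)
    by (simp add: mult.assoc L lower_raise mult_left_absorb[OF f(2)] fid_absorb[OF f(1), THEN mult_left_absorb])
  then show "mv f g" unfolding mv_def by blast
qed

instance fmat :: (ring_1) stable_ring
proof
  fix e f :: "'a fmat" assume "e * e = e" "f * f = f"
  obtain N where N: "bounded_by N (ent e)" "bounded_by N (ent f)" by (rule ex_bounded2)
  show "\<exists>x y g. e * g = 0 \<and> g * e = 0 \<and> f * x = x \<and> x * g = x \<and> g * y = y \<and> y * f = y \<and> x * y = f \<and> y * x = g"
    using shift_copy[OF N \<open>f * f = f\<close>] unfolding orth_def mv_def mviso_def by blast
qed

section \<open>Passage between finite matrices and \<open>fmat\<close>\<close>

definition of_mat :: "'a::ring_1 mat \<Rightarrow> 'a fmat" where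
  "of_mat A = Abs_fmat (\<lambda>i j. if i < dim_row A \<and> j < dim_col A then A $$ (i, j) else 0)"

definition to_mat :: "nat \<Rightarrow> nat \<Rightarrow> 'a::ring_1 fmat \<Rightarrow> 'a mat" where
  "to_mat m k x = mat m k (\<lambda>(i, j). ent x i j)"

lemma ent_of_mat: "ent (of_mat A) i j = (if i < dim_row A \<and> j < dim_col A then A $$ (i, j) else 0)"
  unfolding of_mat_def by (subst ent_Abs[of "max (dim_row A) (dim_col A)"]) (auto simp: bounded_by_def)

lemma to_mat_carrier [simp]: "to_mat m k x \<in> carrier_mat m k"
  by (simp add: to_mat_def)

lemma to_of_mat: "A \<in> carrier_mat m k \<Longrightarrow> to_mat m k (of_mat A) = A"
  by (rule eq_matI) (auto simp: to_mat_def ent_of_mat)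

lemma of_mat_inject: "A \<in> carrier_mat m k \<Longrightarrow> B \<in> carrier_mat m k \<Longrightarrow> of_mat A = of_mat B \<Longrightarrow> A = B"
  by (metis to_of_mat)

lemma of_to_mat: "fid m * x = x \<Longrightarrow> x * fid k = x \<Longrightarrow> of_mat (to_mat m k x) = x"
  by (rule fmat_eqI) (simp add: ent_of_mat to_mat_def, metis ent_fid_mult ent_mult_fid)

lemma of_mat_fid: "A \<in> carrier_mat m k \<Longrightarrow> fid m * of_mat A = of_mat A"
  "A \<in> carrier_mat m k \<Longrightarrow> of_mat A * fid k = of_mat A"
  by (auto intro!: fmat_eqI simp: ent_fid_mult ent_mult_fid ent_of_mat)

lemma of_mat_mult:
  assumes "A \<in> carrier_mat m n" "B \<in> carrier_mat n k"
  shows "of_mat (A * B) = of_mat A * of_mat B"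
proof (rule fmat_eqI)
  fix i j
  have "ent (of_mat A * of_mat B) i j = ent (of_mat A * (fid n * of_mat B)) i j"
    using of_mat_fid(1)[OF assms(2)] by simp
  define N where "N = max m n"
  have "bounded_by N (ent (of_mat A))" using assms by (auto simp: bounded_by_def ent_of_mat N_def)
  then have "ent (of_mat A * of_mat B) i j = (\<Sum>l<N. ent (of_mat A) i l * ent (of_mat B) l j)"
    by (simp add: ent_times)
  also have "\<dots> = (\<Sum>l<n. ent (of_mat A) i l * ent (of_mat B) l j)"
    by (rule sum.mono_neutral_right) (use assms in \<open>auto simp: ent_of_mat N_def\<close>)
  also have "\<dots> = ent (of_mat (A * B)) i j"
    using assms by (auto simp: ent_of_mat scalar_prod_def lessThan_atLeast0 intro!: sum.cong sum.neutral)
  finally show "ent (of_mat (A * B)) i j = ent (of_mat A * of_mat B) i j" by simp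
qed

lemma idem_mat_iff:
  assumes "e \<in> carrier_mat m m"
  shows "idem_mat m e \<longleftrightarrow> of_mat e * of_mat e = of_mat e"
  using assms of_mat_mult[OF assms assms] of_mat_inject[of "e * e" m m e] unfolding idem_mat_def by auto

text \<open>No isomorphisms are gained in the larger ring: absorbing \<open>of_mat e\<close> and
  \<open>of_mat f\<close> confines \<open>x\<close> to the \<open>m\<close> by \<open>k\<close>
  block and \<open>y\<close> to the \<open>k\<close> by \<open>m\<close> block, so both come from
  matrices.\<close>

lemma proj_iso_iff:
  assumes "idem_mat m e" "idem_mat k f"
  shows "proj_iso m e k f \<longleftrightarrow> mv (of_mat e) (of_mat f)"
proof -
  have c: "e \<in> carrier_mat m m" "f \<in> carrier_mat k k" "of_mat e * of_mat e = of_mat e" "of_mat f * of_mat f = of_mat f"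
    using assms idem_mat_iff unfolding idem_mat_def by metis+
  show ?thesis
  proof
    assume "proj_iso m e k f"
    then obtain x y where x: "x \<in> carrier_mat m k" "y \<in> carrier_mat k m"
      "x = e * x * f" "y = f * y * e" "x * y = e" "y * x = f" unfolding proj_iso_def by blast
    have "e * x \<in> carrier_mat m k" "f * y \<in> carrier_mat k m" using x c by auto
    then have "of_mat x = of_mat e * of_mat x * of_mat f" "of_mat y = of_mat f * of_mat y * of_mat e"
      using of_mat_mult x c by metis+
    moreover have "of_mat x * of_mat y = of_mat e" "of_mat y * of_mat x = of_mat f"
      using of_mat_mult x by metis+
    ultimately show "mv (of_mat e) (of_mat f)" unfolding mv_def mviso_def using c by (metis mult.assoc)
  next
    assume "mv (of_mat e) (of_mat f)"
    then obtain x y where "mviso x y (of_mat e) (of_mat f)" unfolding mv_def by blast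
    note h = mvisoD[OF this]
    have "fid m * x = x" "x * fid k = x" "fid k * y = y" "y * fid m = y"
      using h of_mat_fid c(1,2) by (metis mult.assoc)+
    then have x: "of_mat (to_mat m k x) = x" "of_mat (to_mat k m y) = y" using of_to_mat by blast+
    define X where "X = to_mat m k x"
    define Y where "Y = to_mat k m y"
    have X: "X \<in> carrier_mat m k" "Y \<in> carrier_mat k m" unfolding X_def Y_def by auto
    have eX: "e * X \<in> carrier_mat m k" "f * Y \<in> carrier_mat k m" using X c by auto
    have "of_mat X = of_mat (e * X * f)" "of_mat Y = of_mat (f * Y * e)"
      unfolding of_mat_mult[OF eX(1) c(2)] of_mat_mult[OF eX(2) c(1)] of_mat_mult[OF c(1) X(1)] of_mat_mult[OF c(2) X(2)]
      using x h unfolding X_def[symmetric] Y_def[symmetric] by simp_all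
    moreover have "of_mat (X * Y) = of_mat e" "of_mat (Y * X) = of_mat f"
      unfolding of_mat_mult[OF X] of_mat_mult[OF X(2,1)] using x h unfolding X_def[symmetric] Y_def[symmetric] by simp_all
    moreover have "e * X * f \<in> carrier_mat m k" "f * Y * e \<in> carrier_mat k m" "X * Y \<in> carrier_mat m m" "Y * X \<in> carrier_mat k k"
      using X c by auto
    ultimately have "X = e * X * f" "Y = f * Y * e" "X * Y = e" "Y * X = f"
      using of_mat_inject X c(1,2) by metis+
    then show "proj_iso m e k f" unfolding proj_iso_def using X by blast
  qed
qed

text \<open>The block sum becomes \<open>of_mat e\<close> plus the shifted copy of
  \<open>of_mat f\<close>, an orthogonal sum of idempotents.\<close>

lemma dsum_mat_cls:
  assumes "idem_mat m e" "idem_mat k f"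
  shows "idem_mat (m + k) (dsum_mat m e k f)"
    "cls (of_mat (dsum_mat m e k f)) = cls (of_mat e) + cls (of_mat f)"
proof -
  have c: "e \<in> carrier_mat m m" "f \<in> carrier_mat k k" "of_mat e * of_mat e = of_mat e" "of_mat f * of_mat f = of_mat f"
    using assms idem_mat_iff unfolding idem_mat_def by metis+
  define g where "g = raise m k * of_mat f * lower m k"
  have d: "dsum_mat m e k f \<in> carrier_mat (m + k) (m + k)" unfolding dsum_mat_def using c by auto
  have b: "bounded_by m (ent (of_mat e))" "bounded_by k (ent (of_mat f))"
    using c by (auto simp: bounded_by_def ent_of_mat)
  note s = shift_copy[OF b c(4), folded g_def]
  have eq: "of_mat (dsum_mat m e k f) = of_mat e + g"
  proof (rule fmat_eqI)
    fix i j
    show "ent (of_mat (dsum_mat m e k f)) i j = ent (of_mat e + g) i j"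
      using c(1,2) unfolding g_def dsum_mat_def by (auto simp: ent_of_mat ent_raise_mult ent_mult_lower)
  qed
  have "g * g = g" using s mv_idem by blast
  then show "cls (of_mat (dsum_mat m e k f)) = cls (of_mat e) + cls (of_mat f)"
    unfolding eq using cls_add[OF c(3) _ s(1)] s(2) c(4) cls_eq by metis
  show "idem_mat (m + k) (dsum_mat m e k f)"
    unfolding idem_mat_iff[OF d] eq using idem_add[OF c(3) \<open>g * g = g\<close> s(1)] .
qed

section \<open>Exchange and separativity for \<open>fmat\<close>, and transfer of the result\<close>

lemma sum_single_fid: "(\<Sum>i<n. single i i (1::'a::ring_1)) = fid n"
proof (induction n)
  case 0
  show ?case by (rule fmat_eqI) (simp add: ent_fid)
next
  case (Suc n)
  show ?case by (rule fmat_eqI) (auto simp: Suc ent_fid ent_single)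
qed

text \<open>The corner of a diagonal matrix unit is a copy of the base ring, where the condition is
  the definition of an exchange ring.\<close>

lemma exch_single:
  assumes "exchange_ring TYPE('a::ring_1)"
  shows "exch (single i i (1::'a))"
  unfolding exch_def
proof (intro allI impI)
  fix a :: "'a fmat" assume a: "single i i 1 * a = a" "a * single i i 1 = a"
  define r where "r = ent a i i"
  have "a = single i i 1 * a * single i i 1" using a by simp
  also have "\<dots> = single i i r" by (rule fmat_eqI) (auto simp: ent_single_mult ent_mult_single ent_single r_def)
  finally have ar: "a = single i i r" .
  obtain e x s where e: "e * e = e" "e = r * x" "1 - e = (1 - r) * s"
    using assms unfolding exchange_ring_def by meson
  have d: "single i i 1 - single i i t = single i i (1 - t)" for t :: 'a
    by (rule fmat_eqI) (auto simp: ent_single)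
  have "single i i e * single i i e = single i i e" "single i i e * single i i 1 = single i i e"
    "a * single i i x = single i i e" "(single i i 1 - a) * single i i s = single i i 1 - single i i e"
    unfolding ar d using e by (simp_all add: single_mult_single)
  then show "\<exists>g r s. g * g = g \<and> g * single i i 1 = g \<and> a * r = g \<and> (single i i 1 - a) * s = single i i 1 - g"
    by blast
qed

text \<open>\<open>fid n\<close> is an orthogonal sum of diagonal matrix units, so
  \<open>exch_add\<close> applies inductively; every idempotent lies below some
  \<open>fid N\<close>, where \<open>exch_corner\<close> takes over.\<close>

lemma exch_fmat:
  fixes u :: "'a::ring_1 fmat"
  assumes "exchange_ring TYPE('a)" "u * u = u"
  shows "exch u"
proof -
  have fid: "exch (fid n :: 'a fmat) \<and> fid n * fid n = (fid n :: 'a fmat)" for n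
  proof (induction n)
    case 0
    have "fid 0 = (0 :: 'a fmat)" by (rule fmat_eqI) (simp add: ent_fid)
    then show ?case by (simp add: exch_zero)
  next
    case (Suc n)
    have s: "fid (Suc n) = fid n + single n n (1::'a)" by (rule fmat_eqI) (auto simp: ent_fid ent_single)
    have z: "fid n * single n n 1 = (0 :: 'a fmat)" "single n n 1 * fid n = (0 :: 'a fmat)"
      by (rule fmat_eqI, simp add: ent_fid_mult ent_single ent_single_mult ent_fid)+
    show ?case unfolding s
      using exch_add[OF conjunct1[OF Suc] conjunct2[OF Suc] exch_single[OF assms(1)] _ z] z Suc
      by (simp add: single_mult_single algebra_simps)
  qed
  obtain N where "bounded_by N (ent u)" using ex_bounded by blast
  then have "below u (fid N)" using fid_absorb unfolding below_def by blast
  then show ?thesis using exch_corner fid assms(2) by blast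
qed

lemma sep_exch_fmat:
  assumes "exchange_ring TYPE('a::ring_1)" "separative TYPE('a)"
  shows "sep_exch TYPE('a fmat)"
proof
  show "exch u" if "u * u = u" for u :: "'a fmat" using exch_fmat assms(1) that .
next
  \<comment> \<open>Every class comes from an idempotent matrix of finite size, so separativity of
    the base ring, stated for matrices, covers all classes.\<close>
  have ex: "\<exists>m E. idem_mat m E \<and> cls (of_mat E) = x" for x :: "'a fmat idem_class"
  proof -
    obtain e where e: "e * e = e" "cls e = x" using cls_surj by blast
    obtain m where m: "bounded_by m (ent e)" using ex_bounded by blast
    have "of_mat (to_mat m m e) = e" using of_to_mat fid_absorb[OF m] by blast
    then show ?thesis using e idem_mat_iff[OF to_mat_carrier, of m e] by metis
  qed
  have iso: "proj_iso m E k F \<longleftrightarrow> cls (of_mat E) = cls (of_mat F)"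
    if "idem_mat m E" "idem_mat k F" for m k and E F :: "'a mat"
    using proj_iso_iff[OF that] cls_eq that idem_mat_iff unfolding idem_mat_def by metis
  fix x y :: "'a fmat idem_class" assume xy: "x + x = x + y" "x + y = y + y"
  obtain m E where E: "idem_mat m E" "cls (of_mat E) = x" using ex by blast
  obtain k F where F: "idem_mat k F" "cls (of_mat F) = y" using ex by blast
  have "proj_iso (m + m) (dsum_mat m E m E) (m + k) (dsum_mat m E k F)"
    "proj_iso (m + k) (dsum_mat m E k F) (k + k) (dsum_mat k F k F)"
    using iso[OF dsum_mat_cls(1)[OF E(1) E(1)] dsum_mat_cls(1)[OF E(1) F(1)]]
      iso[OF dsum_mat_cls(1)[OF E(1) F(1)] dsum_mat_cls(1)[OF F(1) F(1)]]
      dsum_mat_cls(2)[OF E(1) E(1)] dsum_mat_cls(2)[OF E(1) F(1)] dsum_mat_cls(2)[OF F(1) F(1)] E F xy by simp_all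
  then have "proj_iso m E k F" using assms(2) E F unfolding separative_def by blast
  then show "x = y" using iso E F by blast
qed

text \<open>The two absorption conditions force \<open>x\<close> to be supported at position
  (\<open>i\<close>, \<open>j\<close>), so adding it to the unit \<open>fid n\<close> gives the
  image of a transvection.\<close>

lemma elem_step_of_mat:
  assumes A: "A \<in> carrier_mat n n" and ij: "i < n" "j < n" "i \<noteq> j"
    and x: "single i i 1 * x = x" "x * single j j 1 = x"
    and X: "X = of_mat A + x * of_mat A \<or> X = of_mat A + of_mat A * x"
  shows "\<exists>B. elem_step n A B \<and> B \<in> carrier_mat n n \<and> X = of_mat B"
proof -
  define r where "r = ent x i j"
  have "x = single i i 1 * x * single j j 1" using x by simp
  also have "\<dots> = single i j r" by (rule fmat_eqI) (auto simp: ent_single_mult ent_mult_single ent_single r_def)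
  finally have xr: "x = single i j r" .
  have t: "transvection n i j r \<in> carrier_mat n n" by (simp add: transvection_def)
  have "of_mat (transvection n i j r) = fid n + x"
    unfolding xr by (rule fmat_eqI) (use ij in \<open>auto simp: ent_of_mat ent_fid ent_single transvection_def\<close>)
  then have "of_mat (transvection n i j r * A) = of_mat A + x * of_mat A"
    "of_mat (A * transvection n i j r) = of_mat A + of_mat A * x"
    using of_mat_mult[OF t A] of_mat_mult[OF A t] of_mat_fid[OF A] by (simp_all add: distrib_left distrib_right)
  moreover have "transvection n i j r * A \<in> carrier_mat n n" "A * transvection n i j r \<in> carrier_mat n n"
    using A t by auto
  moreover have "elem_step n A (transvection n i j r * A)" "elem_step n A (A * transvection n i j r)"
    unfolding elem_step_def using ij by blast+
  ultimately show ?thesis using X by metis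
qed

theorem theorem2p10:
  fixes A :: "'a::ring_1 mat" and n :: nat
  assumes "exchange_ring TYPE('a)" and "separative TYPE('a)"
    and "A \<in> carrier_mat n n"
    and "\<exists>B \<in> carrier_mat n n. A * B * A = A"
  shows "\<exists>D. (elem_step n)\<^sup>*\<^sup>* A D \<and> diagonal_mat D"
proof -
  interpret S: sep_exch "TYPE('a fmat)" using sep_exch_fmat assms(1,2) .
  interpret F: frame "TYPE('a fmat)" "\<lambda>i. single i i 1"
  proof
    show "mv (single i i 1) (single j j (1::'a))" for i j
      unfolding mv_def mviso_def
      by (rule exI[of _ "single i j 1"], rule exI[of _ "single j i 1"]) (simp add: single_mult_single)
  qed (simp_all add: single_mult_single)
  obtain B where B: "B \<in> carrier_mat n n" "A * B * A = A" using assms(4) by blast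
  have us: "F.unit_sum n = fid n" unfolding F.unit_sum_def by (rule sum_single_fid)
  have AB: "A * B \<in> carrier_mat n n" using assms(3) B(1) by auto
  have "of_mat A * of_mat B * of_mat A = of_mat A"
    using of_mat_mult[OF AB assms(3)] of_mat_mult[OF assms(3) B(1)] B(2) by simp
  then obtain D where D: "(F.estep n)\<^sup>*\<^sup>* (of_mat A) D"
    and diag: "\<forall>i<n. \<forall>j<n. i \<noteq> j \<longrightarrow> single i i 1 * D * single j j 1 = 0"
    using F.regular_diagonalizable[of n "of_mat A" "of_mat B"]
      of_mat_fid[OF assms(3)] of_mat_fid[OF B(1)] unfolding us by blast
  \<comment> \<open>The chain of abstract steps is pulled back one step at a time, each intermediate
    element being the image of a matrix.\<close>
  have "\<exists>D'. (elem_step n)\<^sup>*\<^sup>* A D' \<and> D' \<in> carrier_mat n n \<and> D = of_mat D'"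
    using D
  proof (induction rule: rtranclp_induct)
    case base
    then show ?case using assms(3) by blast
  next
    case (step X Y)
    then obtain X' where X': "(elem_step n)\<^sup>*\<^sup>* A X'" "X' \<in> carrier_mat n n" "X = of_mat X'" by blast
    obtain Y' where Y': "elem_step n X' Y'" "Y' \<in> carrier_mat n n" "Y = of_mat Y'"
      using step(2) elem_step_of_mat[OF X'(2)] unfolding F.estep_def X'(3) by metis
    show ?case using X'(1) Y' by (blast intro: rtranclp.rtrancl_into_rtrancl)
  qed
  then obtain D' where D': "(elem_step n)\<^sup>*\<^sup>* A D'" "D' \<in> carrier_mat n n" "D = of_mat D'" by blast
  have "D' $$ (i, j) = 0" if "i < n" "j < n" "i \<noteq> j" for i j
  proof -
    have "ent (single i i 1 * D * single j j 1) i j = 0" using diag that by simp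
    then show ?thesis using D' that by (simp add: ent_single_mult ent_mult_single ent_of_mat)
  qed
  then have "diagonal_mat D'" unfolding diagonal_mat_def using D'(2) by auto
  then show ?thesis using D'(1) by blast
qed

end
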